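(* The Fabrykowski-Gupta group $G$ is generated by two elements, contains no free subsemigroup on two generators, and is not a periodic extension of a locally nilpotent group; that is, there is no short exact sequence $1\to N\to G\to P\to 1$ with $N$ locally nilpotent and $P$ periodic (torsion).
   Context: The Fabrykowski-Gupta group: let $A=\mathbb{Z}/3\mathbb{Z}=\{0,1,2\}$, and let $A^*$ be the set of finite words over $A$, viewed as the vertex set of the $3$-regular rooted tree. Let $a$ be the automorphism of the tree cyclically permuting the first-level subtrees, $a(xw)=(x+1)w$ for $x\in A$, $w\in A^*$. Let $t$ be the automorphism defined recursively by $t=\langle\langle a,1,t\rangle\rangle$, i.e. $t(0w)=0\,a(w)$, $t(1w)=1w$, $t(2w)=2\,t(w)$ for $w\in A^*$. Then $G=\langle a,t\rangle\le \mathrm{Aut}(A^* )$. A group is locally nilpotent if each of its finitely generated subgroups is nilpotent. *)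

theory Defs
  imports "HOL-Algebra.Bij" "HOL-Algebra.Generated_Groups" "HOL-Library.Numeral_Type"
begin

section \<open>Group-theoretic notions\<close>

text \<open>The field \<open>one\<close> is a dummy required by the record type (it is not in the carrier): the free
  semigroup on \<open>S\<close> consists of the \<^emph>\<open>nonempty\<close> words, and homomorphisms in the sense of \<^const>\<open>hom\<close>
  respect multiplication only.\<close>

definition free_semigroup :: "'x set \<Rightarrow> 'x list monoid" where
  "free_semigroup S = \<lparr>carrier = {w. w \<noteq> [] \<and> set w \<subseteq> S}, mult = (@), one = []\<rparr>"

definition contains_free_subsemigroup_2 :: "('a, 'b) monoid_scheme \<Rightarrow> bool" where
  "contains_free_subsemigroup_2 G \<longleftrightarrow> (\<exists>\<phi>. \<phi> \<in> mon (free_semigroup {..<2::nat}) G)"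

definition commutator_subgroup :: "('a, 'b) monoid_scheme \<Rightarrow> 'a set \<Rightarrow> 'a set \<Rightarrow> 'a set" where
  "commutator_subgroup G H K =
     generate G (\<Union>h\<in>H. \<Union>k\<in>K. {h \<otimes>\<^bsub>G\<^esub> k \<otimes>\<^bsub>G\<^esub> inv\<^bsub>G\<^esub> h \<otimes>\<^bsub>G\<^esub> inv\<^bsub>G\<^esub> k})"

primrec lower_central :: "('a, 'b) monoid_scheme \<Rightarrow> nat \<Rightarrow> 'a set" where
  "lower_central G 0 = carrier G"
| "lower_central G (Suc n) = commutator_subgroup G (lower_central G n) (carrier G)"

definition nilpotent_group :: "('a, 'b) monoid_scheme \<Rightarrow> bool" where
  "nilpotent_group G \<longleftrightarrow> group G \<and> (\<exists>n. lower_central G n = {\<one>\<^bsub>G\<^esub>})"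

definition locally_nilpotent_group :: "('a, 'b) monoid_scheme \<Rightarrow> bool" where
  "locally_nilpotent_group G \<longleftrightarrow> group G \<and>
     (\<forall>S. finite S \<and> S \<subseteq> carrier G \<longrightarrow> nilpotent_group (subgroup_generated G S))"

definition periodic_group :: "('a, 'b) monoid_scheme \<Rightarrow> bool" where
  "periodic_group G \<longleftrightarrow> group G \<and>
     (\<forall>x\<in>carrier G. \<exists>n::nat. n > 0 \<and> x [^]\<^bsub>G\<^esub> n = \<one>\<^bsub>G\<^esub>)"

text \<open>\<open>1 \<rightarrow> N \<rightarrow> G \<rightarrow> P \<rightarrow> 1\<close> with maps \<open>i\<close> and \<open>p\<close>. The predicate \<open>exact_seq\<close> of HOL-Algebra requires all
  groups to have the same element type, which would restrict the possible \<open>N\<close> and \<open>P\<close>.\<close>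

definition short_exact_sequence ::
  "('n, 'c) monoid_scheme \<Rightarrow> ('n \<Rightarrow> 'a) \<Rightarrow> ('a, 'b) monoid_scheme \<Rightarrow> ('a \<Rightarrow> 'p)
     \<Rightarrow> ('p, 'd) monoid_scheme \<Rightarrow> bool" where
  "short_exact_sequence N i G p P \<longleftrightarrow> group N \<and> group G \<and> group P \<and>
     i \<in> mon N G \<and> p \<in> epi G P \<and> i ` carrier N = kernel G P p"


section \<open>The ternary rooted tree and the Fabrykowski-Gupta group\<close>

text \<open>The alphabet is the type \<open>3\<close> of integers modulo 3; its elements are \<open>0\<close>, \<open>1\<close>, \<open>2\<close>, and
  addition is modulo 3. The vertices of the tree are all words, with root \<open>[]\<close>.\<close>

definition tree_adj :: "3 list \<Rightarrow> 3 list \<Rightarrow> bool" where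
  "tree_adj v w \<longleftrightarrow> (\<exists>x. w = v @ [x]) \<or> (\<exists>x. v = w @ [x])"

definition tree_aut :: "(3 list \<Rightarrow> 3 list) set" where
  "tree_aut = {f. bij f \<and> f [] = [] \<and> (\<forall>v w. tree_adj (f v) (f w) \<longleftrightarrow> tree_adj v w)}"

definition tree_Aut :: "(3 list \<Rightarrow> 3 list) monoid" where
  "tree_Aut = BijGroup UNIV \<lparr>carrier := tree_aut\<rparr>"

fun fg_a :: "3 list \<Rightarrow> 3 list" where
  "fg_a [] = []"
| "fg_a (x # w) = (x + 1) # w"

fun fg_t :: "3 list \<Rightarrow> 3 list" where
  "fg_t [] = []"
| "fg_t (x # w) = (if x = 0 then 0 # fg_a w else if x = 1 then 1 # w else 2 # fg_t w)"

definition FG_group :: "(3 list \<Rightarrow> 3 list) monoid" where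
  "FG_group = subgroup_generated tree_Aut {fg_a, fg_t}"


subsection \<open>Well-definedness\<close>

text \<open>As \<^const>\<open>subgroup_generated\<close> silently intersects its argument with the carrier, it matters
  that \<open>fg_a\<close> and \<open>fg_t\<close> really are tree automorphisms.\<close>

lemma alphabet_cases: "x = 0 \<or> x = 1 \<or> x = (2::3)"
proof (cases x rule: bit1_cases)
  case (of_int z)
  then have "z = 0 \<or> z = 1 \<or> z = 2" by auto
  with of_int show ?thesis by auto
qed

lemma tree_autI:
  assumes "bij f" and len: "\<And>w. length (f w) = length w"
    and child: "\<And>v x. \<exists>y. f (v @ [x]) = f v @ [y]"
  shows "f \<in> tree_aut"
proof -
  have inj: "f u = f v \<longleftrightarrow> u = v" for u v
    using \<open>bij f\<close> by (meson bij_is_inj inj_eq)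
  have step: "(\<exists>y. f w = f v @ [y]) \<longleftrightarrow> (\<exists>x. w = v @ [x])" for v w
  proof
    assume "\<exists>y. f w = f v @ [y]"
    then obtain y where y: "f w = f v @ [y]" by blast
    then have "length w = Suc (length v)" using len[of w] len[of v] by simp
    then obtain u x where w: "w = u @ [x]" by (cases w rule: rev_cases) auto
    obtain z where "f w = f u @ [z]" using child w by blast
    with y have "f u = f v" by simp
    with w inj show "\<exists>x. w = v @ [x]" by blast
  qed (use child in blast)
  show ?thesis
    unfolding tree_aut_def tree_adj_def using assms(1) len[of "[]"] by (auto simp: step)
qed

lemma tree_aut_subset: "tree_aut \<subseteq> Bij UNIV"
  by (auto simp: tree_aut_def Bij_def)

lemma subgroup_tree_aut: "subgroup tree_aut (BijGroup UNIV)"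
proof (rule subgroup.intro)
  show "tree_aut \<subseteq> carrier (BijGroup UNIV)"
    using tree_aut_subset by (simp add: BijGroup_def)
  show "f \<otimes>\<^bsub>BijGroup UNIV\<^esub> g \<in> tree_aut" if "f \<in> tree_aut" "g \<in> tree_aut" for f g
  proof -
    have "f \<otimes>\<^bsub>BijGroup UNIV\<^esub> g = f \<circ> g"
      using that tree_aut_subset by (auto simp: BijGroup_def compose_def fun_eq_iff)
    with that show ?thesis by (auto simp: tree_aut_def bij_comp)
  qed
  show "\<one>\<^bsub>BijGroup UNIV\<^esub> \<in> tree_aut"
    by (auto simp: BijGroup_def tree_aut_def bij_def inj_def)
  show "inv\<^bsub>BijGroup UNIV\<^esub> f \<in> tree_aut" if f: "f \<in> tree_aut" for f
  proof -
    have "bij f" using f by (simp add: tree_aut_def)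
    then have *: "f (inv_into UNIV f v) = v" "inv_into UNIV f (f v) = v" for v
      by (simp_all add: bij_is_surj surj_f_inv_f bij_is_inj)
    have "inv\<^bsub>BijGroup UNIV\<^esub> f = inv_into UNIV f"
      using f tree_aut_subset by (subst inv_BijGroup) (auto simp: fun_eq_iff)
    moreover have "inv_into UNIV f \<in> tree_aut"
      using f * bij_imp_bij_inv[OF \<open>bij f\<close>] unfolding tree_aut_def mem_Collect_eq by metis
    ultimately show ?thesis by simp
  qed
qed

lemma group_tree_Aut: "group tree_Aut"
  unfolding tree_Aut_def by (rule subgroup.subgroup_is_group[OF subgroup_tree_aut group_BijGroup])

lemma mult_tree_Aut:
  assumes "f \<in> carrier tree_Aut" "g \<in> carrier tree_Aut"
  shows "f \<otimes>\<^bsub>tree_Aut\<^esub> g = f \<circ> g"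
  using assms tree_aut_subset by (auto simp: tree_Aut_def BijGroup_def compose_def fun_eq_iff)

lemma fg_a_cubed: "fg_a (fg_a (fg_a w)) = w"
  by (cases w) (use alphabet_cases in auto)

lemma fg_t_cubed: "fg_t (fg_t (fg_t w)) = w"
proof (induction w)
  case (Cons x w)
  then show ?case using alphabet_cases[of x] by (auto simp: fg_a_cubed)
qed simp

lemma fg_a_tree_aut: "fg_a \<in> tree_aut"
proof (rule tree_autI)
  show "bij fg_a" by (rule o_bij[where g = "fg_a \<circ> fg_a"]) (auto simp: fun_eq_iff fg_a_cubed)
  show "length (fg_a w) = length w" for w by (cases w) auto
  show "\<exists>y. fg_a (v @ [x]) = fg_a v @ [y]" for v x by (cases v) auto
qed

lemma fg_t_tree_aut: "fg_t \<in> tree_aut"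
proof (rule tree_autI)
  have *: "length (fg_a w) = length w" for w by (cases w) auto
  have **: "\<exists>y. fg_a (v @ [x]) = fg_a v @ [y]" for v x by (cases v) auto
  show "bij fg_t" by (rule o_bij[where g = "fg_t \<circ> fg_t"]) (auto simp: fun_eq_iff fg_t_cubed)
  show "length (fg_t w) = length w" for w by (induction w) (auto simp: *)
  show "\<exists>y. fg_t (v @ [x]) = fg_t v @ [y]" for v x by (induction v) (auto simp: **)
qed

lemma carrier_FG_group: "carrier FG_group = generate tree_Aut {fg_a, fg_t}"
  using fg_a_tree_aut fg_t_tree_aut
  by (simp add: FG_group_def subgroup_generated_def tree_Aut_def)

lemma group_FG_group: "group FG_group"
  unfolding FG_group_def by (rule group.group_subgroup_generated[OF group_tree_Aut])

end

theory Submission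
  imports Defs Complex_Main
begin

text \<open>
  Write \<open>a\<close> for the rotation and \<open>t = \<langle>\<langle>a, 1, t\<rangle>\<rangle>\<close> for the other generator. Every element of the group is a
  word in the conjugates \<open>t\<^sub>i = a\<^sup>i t a\<^sup>-\<^sup>i\<close> and their powers, followed by a power of \<open>a\<close>; its length is
  the least number of letters needed.

  \<^bold>\<open>No free subsemigroup.\<close> A free subsemigroup on two generators would force exponential growth, so
  it suffices that balls grow subexponentially. The three sections of a letter are a power of \<open>a\<close>, the
  identity and a power of \<open>t\<close>, so the lengths of the sections of \<open>g\<close> add up to at most the length of
  \<open>g\<close>. This alone gives no contraction, and none is possible for all elements: the odometer
  \<open>at\<close> satisfies \<open>(at)\<^sup>3 = \<langle>\<langle>ta, at, at\<rangle>\<rangle>\<close>. However, the words that lose nothing on the first two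
  levels (\<open>tight\<close> words) are rare. A subword of letters with indices \<open>i, i + 1, i\<close> already loses a letter on the first level, hence
  the indices of a tight word first descend and then ascend through \<open>\<int>/3\<close>; on a monotone stretch the
  sections are words whose steps are given by every third exponent, and the same prohibition on
  the second level makes these exponents monotone as well, up to boundedly many positions. So there are only polynomially many tight
  words of length \<open>L\<close> (\<open>card_tight_words\<close>).

  Cut a word into blocks of length \<open>L\<close>. If a fixed proportion of the blocks is not tight, the total
  length of the nine sections on the second level is shorter by a constant factor; the words with
  fewer such blocks are few. Hence any bound \<open>C \<rho>\<^sup>n\<close> with \<open>\<rho> > 1\<close> for the ball sizes can be
  improved to one with a smaller base (\<open>growth_le_improve\<close>), and the infimum of the possible bases is \<open>1\<close>.

  \<^bold>\<open>No periodic extension of a locally nilpotent group.\<close> The odometer has infinite order, so a kernel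
  \<open>N\<close> with periodic quotient contains some \<open>f \<noteq> 1\<close>; let \<open>f\<close> move the vertex \<open>v\<close>. The derived subgroup
  \<open>D\<close> is finitely generated and branching: for \<open>d\<close> in \<open>D\<close>, the automorphism \<open>\<delta>\<^sub>v(d)\<close> that acts as \<open>d\<close>
  below \<open>v\<close> and trivially elsewhere is again in \<open>D\<close>. The commutators \<open>[f, \<delta>\<^sub>v(d)]\<close>, for \<open>d\<close> in a finite
  generating set, lie in \<open>N\<close> and have the section \<open>d\<^sup>-\<^sup>1\<close> at \<open>v\<close>. They generate a subgroup of \<open>N\<close> that maps
  onto \<open>D\<close>, and \<open>D\<close> is not nilpotent: if \<open>1 \<noteq> h \<in> D\<close> moves \<open>u\<close>, then \<open>[h, \<delta>\<^sub>u(k)] \<noteq> 1\<close> for every \<open>k \<noteq> 1\<close>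
  in \<open>D\<close>, so no term of the lower central series is trivial.
\<close>

section \<open>The group as a set of words in rotations and spinal letters\<close>

lemma UNIV_alphabet: "(UNIV :: 3 set) = {0, 1, 2}"
  using alphabet_cases by auto

lemma sum_alphabet: "(\<Sum>x\<in>UNIV. f (x::3)) = f i + f (i + 1) + f (i + 2)"
proof -
  have three: "(3::3) = 0" and four: "(4::3) = 1" by simp_all
  have "(\<Sum>x\<in>UNIV. f x) = f 0 + f 1 + f 2"
    unfolding UNIV_alphabet by (simp add: add.assoc)
  with alphabet_cases[of i] show ?thesis by (auto simp: add_ac three four)
qed

fun rot :: "3 \<Rightarrow> 3 list \<Rightarrow> 3 list" where
  "rot c [] = []"
| "rot c (x # w) = (x + c) # w"

text \<open>The automorphism \<open>a\<^sup>i t\<^sup>f a\<^sup>-\<^sup>i\<close>. As \<open>t\<close> has order 3, exponents \<open>f\<close> in \<open>\<int>/3\<close> cover its powers and inverses;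
  the trivial exponent \<open>0\<close> serves to pad words to a prescribed length.\<close>

fun spin :: "3 \<Rightarrow> 3 \<Rightarrow> 3 list \<Rightarrow> 3 list" where
  "spin i f [] = []"
| "spin i f (x # w) = x # (if x = i then rot f w else if x = i + 1 then w else spin 0 f w)"

lemma fg_a_eq_rot: "fg_a = rot 1"
proof
  show "fg_a w = rot 1 w" for w by (cases w) auto
qed

lemma fg_t_eq_spin: "fg_t = spin 0 1"
proof
  show "fg_t w = spin 0 1 w" for w
  proof (induction w)
    case (Cons x w)
    then show ?case using alphabet_cases[of x] by (auto simp: fg_a_eq_rot)
  qed simp
qed

lemma rot_0: "rot 0 = id"
proof
  show "rot 0 w = id w" for w by (cases w) auto
qed

lemma rot_rot: "rot c (rot d w) = rot (c + d) w"
  by (cases w) (auto simp: ac_simps)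

lemma rot_comp: "rot c \<circ> rot d = rot (c + d)"
  by (simp add: fun_eq_iff rot_rot)

lemma spin_0: "spin i 0 = id"
proof
  have *: "spin 0 0 w = w" for w by (induction w) (auto simp: rot_0)
  show "spin i 0 w = id w" for w by (cases w) (auto simp: * rot_0)
qed

lemma spin_spin: "spin i f (spin i g w) = spin i (f + g) w"
proof -
  have *: "spin 0 f (spin 0 g w) = spin 0 (f + g) w" for w by (induction w) (auto simp: rot_rot)
  show ?thesis by (cases w) (auto simp: * rot_rot)
qed

lemma spin_comp: "spin i f \<circ> spin i g = spin i (f + g)"
  by (simp add: fun_eq_iff spin_spin)

text \<open>This relation moves all rotations in a product to the right end, at the price of shifting the
  indices of the letters that they pass.\<close>

lemma rot_spin: "rot c \<circ> spin i f = spin (i + c) f \<circ> rot c"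
proof
  show "(rot c \<circ> spin i f) w = (spin (i + c) f \<circ> rot c) w" for w
    by (cases w) (auto simp: algebra_simps)
qed

primrec elt :: "(3 \<times> 3) list \<Rightarrow> 3 \<Rightarrow> 3 list \<Rightarrow> 3 list" where
  "elt [] c = rot c"
| "elt (l # w) c = spin (fst l) (snd l) \<circ> elt w c"

definition FG :: "(3 list \<Rightarrow> 3 list) set" where
  "FG = {elt w c | w c. True}"

lemma elt_append: "elt (u @ v) c = elt u 0 \<circ> elt v c"
  by (induction u) (auto simp: rot_0 comp_assoc)

lemma rot_elt: "rot c \<circ> elt w d = elt (map (\<lambda>(i, f). (i + c, f)) w) (c + d)"
proof (induction w)
  case (Cons l w)
  have "rot c \<circ> elt (l # w) d = spin (fst l + c) (snd l) \<circ> (rot c \<circ> elt w d)"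
    using rot_spin[of c "fst l" "snd l"] by (simp add: comp_assoc flip: comp_assoc)
  then show ?case unfolding Cons.IH by (simp add: case_prod_unfold del: comp_apply)
qed (simp add: rot_comp)

lemma elt_eq: "elt w c = elt w 0 \<circ> rot c"
  using elt_append[of w "[]" c] by simp

lemma elt_comp: "elt u c \<circ> elt v d = elt (u @ map (\<lambda>(i, f). (i + c, f)) v) (c + d)"
  by (simp add: elt_append elt_eq[of u c] comp_assoc rot_elt)

lemma elt_in_FG [simp, intro]: "elt w c \<in> FG"
  by (auto simp: FG_def)

lemma FG_cases: "g \<in> FG \<Longrightarrow> (\<And>w c. g = elt w c \<Longrightarrow> thesis) \<Longrightarrow> thesis"
  by (auto simp: FG_def)

lemma comp_in_FG [intro]: "g \<in> FG \<Longrightarrow> h \<in> FG \<Longrightarrow> g \<circ> h \<in> FG"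
  by (auto elim!: FG_cases simp: elt_comp)

lemma rot_in_FG [simp, intro]: "rot c \<in> FG"
  using elt_in_FG[of "[]" c] by simp

lemma id_in_FG [simp, intro]: "id \<in> FG"
  using rot_in_FG[of 0] by (simp add: rot_0)

lemma spin_eq_elt: "spin i f = elt [(i, f)] 0"
  by (simp add: rot_0)

lemma spin_in_FG [simp, intro]: "spin i f \<in> FG"
  unfolding spin_eq_elt by blast

lemma FG_induct [consumes 1, case_names rot spin]:
  assumes "g \<in> FG" "\<And>c. P (rot c)" "\<And>i f h. h \<in> FG \<Longrightarrow> P h \<Longrightarrow> P (spin i f \<circ> h)"
  shows "P g"
proof -
  have "P (elt w c)" for w c
  proof (induction w)
    case (Cons l w)
    show ?case unfolding elt.simps using Cons by (intro assms(3)) auto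
  qed (simp add: assms(2))
  then show ?thesis using assms(1) by (auto elim: FG_cases)
qed

lemma rot_tree_aut: "rot c \<in> tree_aut"
proof (rule tree_autI)
  show "bij (rot c)" by (rule o_bij[where g = "rot (-c)"]) (auto simp: rot_comp rot_0)
  show "length (rot c w) = length w" for w by (cases w) auto
  show "\<exists>y. rot c (v @ [x]) = rot c v @ [y]" for v x by (cases v) auto
qed

lemma length_spin: "length (spin i f w) = length w"
proof -
  have r: "length (rot c w) = length w" for w c by (cases w) auto
  have "length (spin 0 f w) = length w" for w by (induction w) (auto simp: r)
  then show ?thesis by (cases w) (auto simp: r)
qed

lemma spin_tree_aut: "spin i f \<in> tree_aut"
proof (rule tree_autI)
  show "bij (spin i f)" by (rule o_bij[where g = "spin i (-f)"]) (auto simp: spin_comp spin_0)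
  show "length (spin i f w) = length w" for w by (rule length_spin)
  have r: "\<exists>y. rot c (v @ [x]) = rot c v @ [y]" for v x c by (cases v) auto
  have "\<exists>y. spin 0 f (v @ [x]) = spin 0 f v @ [y]" for v x by (induction v) (auto simp: r)
  then show "\<exists>y. spin i f (v @ [x]) = spin i f v @ [y]" for v x by (cases v) (auto simp: r)
qed

lemma carrier_tree_Aut: "carrier tree_Aut = tree_aut"
  by (simp add: tree_Aut_def)

lemma one_tree_Aut: "\<one>\<^bsub>tree_Aut\<^esub> = id"
  by (auto simp: tree_Aut_def BijGroup_def fun_eq_iff)

lemma FG_subset_tree_aut: "FG \<subseteq> tree_aut"
proof
  interpret group tree_Aut by (rule group_tree_Aut)
  show "g \<in> tree_aut" if "g \<in> FG" for g
    using that
  proof (induction rule: FG_induct)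
    case (spin i f h)
    then show ?case
      using m_closed[of "spin i f" h]
      by (simp add: carrier_tree_Aut spin_tree_aut mult_tree_Aut del: comp_apply)
  qed (rule rot_tree_aut)
qed

lemma FG_inverse:
  assumes "g \<in> FG"
  obtains h where "h \<in> FG" "h \<circ> g = id" "g \<circ> h = id"
proof -
  have "\<exists>h\<in>FG. h \<circ> g = id \<and> g \<circ> h = id"
    using assms
  proof (induction rule: FG_induct)
    case (rot c)
    show ?case by (rule bexI[of _ "rot (-c)"]) (auto simp: rot_comp rot_0)
  next
    case (spin i f h)
    then obtain k where k: "k \<in> FG" "k \<circ> h = id" "h \<circ> k = id" by blast
    have "(k \<circ> spin i (-f)) \<circ> (spin i f \<circ> h) = k \<circ> (spin i (-f) \<circ> spin i f) \<circ> h"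
      by (simp only: comp_assoc)
    moreover have "(spin i f \<circ> h) \<circ> (k \<circ> spin i (-f)) = spin i f \<circ> (h \<circ> k) \<circ> spin i (-f)"
      by (simp only: comp_assoc)
    ultimately show ?case
      using k by (intro bexI[of _ "k \<circ> spin i (-f)"]) (simp_all add: spin_comp spin_0 comp_in_FG del: comp_apply)
  qed
  then show ?thesis using that by blast
qed

text \<open>Products of letters and rotations are closed under inverses because \<open>a\<close> and \<open>t\<close> have finite order.\<close>

lemma carrier_FG: "carrier FG_group = FG"
proof -
  interpret T: group tree_Aut by (rule group_tree_Aut)
  let ?A = "generate tree_Aut {fg_a, fg_t}"
  have gens: "{fg_a, fg_t} \<subseteq> carrier tree_Aut"
    by (simp add: carrier_tree_Aut fg_a_tree_aut fg_t_tree_aut)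
  have sub: "g \<in> ?A \<Longrightarrow> g \<in> tree_aut" for g
    using T.generate_in_carrier[OF gens] by (simp add: carrier_tree_Aut)
  have comp: "g \<circ> h \<in> ?A" if "g \<in> ?A" "h \<in> ?A" for g h
    using generate.eng[OF that] that by (simp add: mult_tree_Aut carrier_tree_Aut sub)
  have id: "id \<in> ?A"
    using generate.one[of tree_Aut] by (simp add: one_tree_Aut)
  have a: "rot 1 \<in> ?A" and t: "spin 0 1 \<in> ?A"
    by (auto intro: generate.incl simp: fg_a_eq_rot fg_t_eq_spin)
  have rots: "rot c \<in> ?A" for c
    using alphabet_cases[of c] id a comp[OF a a] by (auto simp: rot_0 rot_comp)
  have spins0: "spin 0 f \<in> ?A" for f
    using alphabet_cases[of f] id t comp[OF t t] by (auto simp: spin_0 spin_comp)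
  have spins: "spin i f \<in> ?A" for i f
  proof -
    have "spin i f = rot i \<circ> spin 0 f \<circ> rot (-i)"
      using rot_spin[of i 0 f] by (simp add: comp_assoc rot_comp rot_0)
    then show ?thesis using comp rots spins0 by metis
  qed
  have "g \<in> ?A" if "g \<in> FG" for g
    using that
  proof (induction rule: FG_induct)
    case (spin i f h)
    then show ?case by (intro comp spins)
  qed (rule rots)
  moreover have "g \<in> FG" if "g \<in> ?A" for g
    using that
  proof (induction rule: generate.induct)
    case one
    show ?case unfolding one_tree_Aut by (rule id_in_FG)
  next
    case (incl h)
    then show ?case by (auto simp: fg_a_eq_rot fg_t_eq_spin)
  next
    case (inv h)
    then have h: "h \<in> FG" by (auto simp: fg_a_eq_rot fg_t_eq_spin)
    then obtain k where k: "k \<in> FG" "k \<circ> h = id" by (rule FG_inverse)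
    have "inv\<^bsub>tree_Aut\<^esub> h = k"
      using h k FG_subset_tree_aut mult_tree_Aut[of k h]
      by (intro T.inv_equality) (auto simp: carrier_tree_Aut one_tree_Aut)
    with k show ?case by simp
  next
    case (eng g h)
    then show ?case
      using FG_subset_tree_aut mult_tree_Aut[of g h] comp_in_FG[of g h]
      by (simp add: carrier_tree_Aut subset_iff del: comp_apply)
  qed
  ultimately show ?thesis by (auto simp: carrier_FG_group)
qed

lemma mult_FG: "g \<in> FG \<Longrightarrow> h \<in> FG \<Longrightarrow> g \<otimes>\<^bsub>FG_group\<^esub> h = g \<circ> h"
  using FG_subset_tree_aut mult_tree_Aut[of g h]
  by (auto simp: FG_group_def subgroup_generated_def carrier_tree_Aut)

lemma one_FG: "\<one>\<^bsub>FG_group\<^esub> = id"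
  by (simp add: FG_group_def subgroup_generated_def one_tree_Aut)

lemma FG_two_generated:
  "\<exists>S. S \<subseteq> carrier FG_group \<and> card S = 2 \<and> generate FG_group S = carrier FG_group"
proof (intro exI conjI)
  show sub: "{fg_a, fg_t} \<subseteq> carrier FG_group"
    by (auto simp: carrier_FG fg_a_eq_rot fg_t_eq_spin)
  have "fg_a [0] \<noteq> fg_t [0]" by simp
  then have "fg_a \<noteq> fg_t" by metis
  then show "card {fg_a, fg_t} = 2" by simp
  have "generate FG_group {fg_a, fg_t} = generate tree_Aut {fg_a, fg_t}"
  proof -
    interpret T: group tree_Aut by (rule group_tree_Aut)
    have "subgroup FG tree_Aut"
      using T.generate_is_subgroup[of "{fg_a, fg_t}"] carrier_FG carrier_FG_group
      by (simp add: carrier_tree_Aut fg_a_tree_aut fg_t_tree_aut)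
    then have "generate (tree_Aut\<lparr>carrier := FG\<rparr>) {fg_a, fg_t} = generate tree_Aut {fg_a, fg_t}"
      using sub by (intro T.generate_consistent) (auto simp: carrier_FG)
    moreover have "FG_group = tree_Aut\<lparr>carrier := FG\<rparr>"
      using carrier_FG unfolding FG_group_def subgroup_generated_def by simp
    ultimately show ?thesis by simp
  qed
  then show "generate FG_group {fg_a, fg_t} = carrier FG_group"
    unfolding carrier_FG_group .
qed

section \<open>Sections\<close>

definition sec :: "(3 list \<Rightarrow> 3 list) \<Rightarrow> 3 \<Rightarrow> 3 list \<Rightarrow> 3 list" where
  "sec g x w = tl (g (x # w))"

text \<open>The action of \<open>g\<close> on the first level is the translation by \<open>c\<close>.\<close>

definition shifts :: "(3 list \<Rightarrow> 3 list) \<Rightarrow> 3 \<Rightarrow> bool" where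
  "shifts g c \<longleftrightarrow> (\<forall>x w. g (x # w) = (x + c) # sec g x w)"

lemma shifts_comp:
  assumes "shifts g c" "shifts h d"
  shows "shifts (g \<circ> h) (c + d)" "sec (g \<circ> h) x = sec g (x + d) \<circ> sec h x"
proof -
  have g: "g (y # w) = (y + c) # sec g y w" and h: "h (y # w) = (y + d) # sec h y w" for y w
    using assms by (auto simp: shifts_def)
  have gh: "(g \<circ> h) (y # w) = (y + (c + d)) # sec g (y + d) (sec h y w)" for y w
    by (simp add: g h ac_simps)
  then have *: "sec (g \<circ> h) y w = sec g (y + d) (sec h y w)" for y w
    unfolding sec_def by (metis list.sel(3))
  from gh show "shifts (g \<circ> h) (c + d)"
    unfolding shifts_def * by blast
  show "sec (g \<circ> h) x = sec g (x + d) \<circ> sec h x"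
    by (simp add: fun_eq_iff *)
qed

lemma shifts_rot: "shifts (rot c) c" and sec_rot: "sec (rot c) x = id"
  by (auto simp: shifts_def sec_def fun_eq_iff)

lemma shifts_spin: "shifts (spin i f) 0"
  and sec_spin: "sec (spin i f) x = (if x = i then rot f else if x = i + 1 then id else spin 0 f)"
  by (auto simp: shifts_def sec_def fun_eq_iff)

lemma shifts_elt: "shifts (elt w c) c"
proof (induction w)
  case (Cons l w)
  then show ?case using shifts_comp(1)[OF shifts_spin Cons.IH] by (simp del: comp_apply)
qed (simp add: shifts_rot)

lemma sec_elt_Cons: "sec (elt (l # w) c) x = sec (spin (fst l) (snd l)) (x + c) \<circ> sec (elt w c) x"
  by (simp add: shifts_comp(2)[OF shifts_spin shifts_elt])

lemma FG_shifts: "g \<in> FG \<Longrightarrow> \<exists>c. shifts g c"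
  by (auto elim!: FG_cases intro: shifts_elt)

lemma sec_in_FG: "g \<in> FG \<Longrightarrow> sec g x \<in> FG"
proof (induction rule: FG_induct)
  case (spin i f h)
  obtain c where "shifts h c" using FG_shifts spin by blast
  then have "sec (spin i f \<circ> h) x = sec (spin i f) (x + c) \<circ> sec h x"
    using shifts_comp(2)[OF shifts_spin] by blast
  then show ?case using spin by (simp add: sec_spin comp_in_FG del: comp_apply id_apply)
qed (simp add: sec_rot del: id_apply)

lemma FG_Nil: "g \<in> FG \<Longrightarrow> g [] = []"
  by (induction rule: FG_induct) auto

lemma FG_eqI:
  assumes "g \<in> FG" "h \<in> FG" "shifts g c" "shifts h c" "\<And>x. sec g x = sec h x"
  shows "g = h"
proof
  fix w
  show "g w = h w"
    using assms by (cases w) (auto simp: FG_Nil shifts_def)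
qed

section \<open>A finitely generated subgroup with branching\<close>

lemma FG_length: "g \<in> FG \<Longrightarrow> length (g w) = length w"
proof (induction arbitrary: w rule: FG_induct)
  case (rot c)
  show ?case by (cases w) auto
qed (simp add: length_spin)

lemma spin_prefix: "take (length v) (spin i f (v @ u)) = spin i f v"
proof -
  have rot: "take (length v) (rot c (v @ u)) = rot c v" for c v u by (cases v) auto
  have "take (length v) (spin 0 f (v @ u)) = spin 0 f v" for v
    by (induction v) (auto simp: rot)
  then show ?thesis by (cases v) (auto simp: rot)
qed

lemma FG_prefix: "g \<in> FG \<Longrightarrow> take (length v) (g (v @ u)) = g v"
proof (induction rule: FG_induct)
  case (rot c)
  show ?case by (cases v) auto
next
  case (spin i f h)
  have "h (v @ u) = h v @ drop (length v) (h (v @ u))"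
    by (metis append_take_drop_id spin.IH)
  then show ?case
    using spin_prefix[of "h v" i f] FG_length[OF spin.hyps] by (metis comp_apply)
qed

text \<open>The derived subgroup, generated as a monoid by
  \<open>a\<^sup>i t\<^sup>f a\<^sup>-\<^sup>i \<cdot> a\<^sup>j t\<^sup>-\<^sup>f a\<^sup>-\<^sup>j = [a\<^sup>i\<^sup>-\<^sup>j, a\<^sup>j t\<^sup>f a\<^sup>-\<^sup>j]\<close>. The set of these generators is finite, closed under inverses
  and closed under conjugation by \<open>a\<close>, and it needs no words beyond the letters, which keeps the branching
  identity below short.\<close>

inductive_set FG_derived :: "(3 list \<Rightarrow> 3 list) set" where
  id: "id \<in> FG_derived"
| comp: "h \<in> FG_derived \<Longrightarrow> spin i f \<circ> (spin j (- f) \<circ> h) \<in> FG_derived"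

lemma FG_derived_in_FG: "h \<in> FG_derived \<Longrightarrow> h \<in> FG"
  by (induction rule: FG_derived.induct) (rule id_in_FG, intro comp_in_FG spin_in_FG)

lemma FG_derived_gen: "spin i f \<circ> spin j (- f) \<in> FG_derived"
  using FG_derived.comp[OF FG_derived.id] by simp

lemma FG_derived_comp: "g \<in> FG_derived \<Longrightarrow> h \<in> FG_derived \<Longrightarrow> g \<circ> h \<in> FG_derived"
proof (induction rule: FG_derived.induct)
  case (comp g i f j)
  then show ?case unfolding comp_assoc by (intro FG_derived.comp)
qed simp

lemma FG_derived_inverse:
  assumes "h \<in> FG_derived"
  obtains k where "k \<in> FG_derived" "k \<circ> h = id" "h \<circ> k = id"
proof -
  have "\<exists>k\<in>FG_derived. (\<forall>w. k (h w) = w) \<and> (\<forall>w. h (k w) = w)"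
    using assms
  proof (induction rule: FG_derived.induct)
    case id
    show ?case by (rule bexI[OF _ FG_derived.id]) simp
  next
    case (comp h i f j)
    then obtain k where k: "k \<in> FG_derived" "\<And>w. k (h w) = w" "\<And>w. h (k w) = w" by blast
    have "k \<circ> (spin j f \<circ> spin i (- f)) \<in> FG_derived"
      by (rule FG_derived_comp[OF k(1) FG_derived_gen])
    with k(2,3) show ?case
      by (intro bexI[of _ "k \<circ> (spin j f \<circ> spin i (- f))"]) (simp_all add: spin_spin spin_0)
  qed
  then obtain k where "k \<in> FG_derived" "\<And>w. k (h w) = w" "\<And>w. h (k w) = w" by blast
  then show ?thesis by (intro that[of k]) (auto simp: fun_eq_iff)
qed

definition below :: "3 list \<Rightarrow> (3 list \<Rightarrow> 3 list) \<Rightarrow> 3 list \<Rightarrow> 3 list" where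
  "below v h w = (if take (length v) w = v then v @ h (drop (length v) w) else w)"

lemma below_append [simp]: "below v h (v @ u) = v @ h u"
  by (simp add: below_def)

lemma below_Cons: "below (x # v) h = below [x] (below v h)"
proof
  fix w
  show "below (x # v) h w = below [x] (below v h) w"
    by (cases w) (auto simp: below_def)
qed

lemma below_comp: "below v (g \<circ> h) = below v g \<circ> below v h"
  by (auto simp: below_def fun_eq_iff)

lemma below_id: "below v id = id"
proof
  fix w
  show "below v id w = id w"
    by (simp add: below_def) (metis append_take_drop_id)
qed

lemma below_inverse: "d \<circ> d' = id \<Longrightarrow> below v d \<circ> below v d' = id"
  by (simp add: below_id del: comp_apply id_apply flip: below_comp)

text \<open>The letters \<open>spin x i\<close> and \<open>spin (x + 1) f\<close> have the sections \<open>a\<^sup>i\<close> and \<open>t\<^sup>f\<close> at \<open>x\<close>, while at each of the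
  other two vertices one of them is trivial. So their commutator is concentrated at \<open>x\<close>, where it
  is \<open>[a\<^sup>i, t\<^sup>f]\<close>. The right hand side is the product of \<open>[a\<^sup>i, t\<^sup>f]\<close> and the inverse of \<open>[a\<^sup>j, t\<^sup>f]\<close>, both
  placed below \<open>x\<close>, after cancellation.\<close>

lemma below_gen:
  "below [x] (spin i f \<circ> spin j (- f)) =
     spin x i \<circ> (spin (x + 1) f \<circ> (spin x (j - i) \<circ> (spin (x + 1) (- f) \<circ> spin x (- j))))"
proof
  fix w
  have conj: "spin k g u = rot k (spin 0 g (rot (- k) u))" for k g u
    using fun_cong[OF rot_spin[of k 0 g], of "rot (- k) u"] by (simp add: rot_rot rot_0)
  show "below [x] (spin i f \<circ> spin j (- f)) w =
    (spin x i \<circ> (spin (x + 1) f \<circ> (spin x (j - i) \<circ> (spin (x + 1) (- f) \<circ> spin x (- j))))) w"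
  proof (cases w)
    case (Cons y u)
    have "y = x \<or> y = x + 1 \<or> y = x + 2"
      using alphabet_cases[of "y - x"] by (auto simp: algebra_simps)
    then show ?thesis
    proof (elim disjE)
      assume "y = x"
      then show ?thesis
        using Cons conj[of i f] conj[of j "- f"] by (simp add: below_def rot_rot)
    next
      assume "y = x + 1"
      then show ?thesis using Cons by (simp add: below_def rot_rot rot_0)
    next
      assume "y = x + 2"
      then show ?thesis using Cons by (simp add: below_def spin_spin spin_0)
    qed
  qed (simp add: below_def)
qed

text \<open>The exponents in \<open>below_gen\<close> add up to \<open>0\<close>. Splitting the inner letters pairs each letter with one of
  opposite exponent, which exhibits the product as a product of generators.\<close>

lemma below_letter_in_FG_derived: "h \<in> FG_derived \<Longrightarrow> below [x] h \<in> FG_derived"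
proof (induction rule: FG_derived.induct)
  case id
  show ?case unfolding below_id by (rule FG_derived.id)
next
  case (comp h i f j)
  let ?y = "x + 1"
  have "below [x] (spin i f \<circ> spin j (- f)) =
      (spin x i \<circ> (spin ?y (- i) \<circ> (spin ?y (i + f) \<circ> (spin x (- (i + f)) \<circ>
      (spin x (j + f) \<circ> (spin ?y (- (j + f)) \<circ> (spin ?y j \<circ> (spin x (- j) \<circ> id))))))))"
    unfolding below_gen by (simp add: fun_eq_iff spin_spin)
  also have "\<dots> \<in> FG_derived"
    by (intro FG_derived.comp FG_derived.id)
  finally have "below [x] (spin i f \<circ> spin j (- f)) \<in> FG_derived" .
  then have "below [x] (spin i f \<circ> spin j (- f)) \<circ> below [x] h \<in> FG_derived"
    using comp.IH by (rule FG_derived_comp)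
  then show ?case by (simp only: below_comp comp_assoc)
qed

lemma below_in_FG_derived: "h \<in> FG_derived \<Longrightarrow> below v h \<in> FG_derived"
proof (induction v)
  case Nil
  have "below [] h = h" by (simp add: below_def fun_eq_iff)
  with Nil show ?case by simp
next
  case (Cons x v)
  then have "below [x] (below v h) \<in> FG_derived" by (intro below_letter_in_FG_derived) simp
  then show ?case by (subst below_Cons)
qed

text \<open>The conjugate by \<open>g\<close> of an automorphism supported below \<open>v\<close> is supported below \<open>g v\<close>, which is disjoint
  from the vertices below \<open>v\<close>. Hence only the last factor of the commutator is seen below \<open>v\<close>.\<close>

lemma commutator_below:
  assumes g: "g' \<in> FG" "g \<circ> g' = id" "g v \<noteq> v"
  shows "g (below v d (g' (below v d' (v @ u)))) = v @ d' u"
proof -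
  have gg': "g (g' w) = w" for w using g(2) by (metis comp_apply id_apply)
  have "take (length v) (g' (v @ d' u)) = g' v" by (rule FG_prefix[OF g(1)])
  moreover have "g' v \<noteq> v" using gg'[of v] g(3) by auto
  ultimately have "below v d (g' (v @ d' u)) = g' (v @ d' u)" by (simp add: below_def)
  then show ?thesis by (simp add: gg')
qed

lemma lower_central_in_carrier: "group G \<Longrightarrow> lower_central G n \<subseteq> carrier G"
proof (induction n)
  case (Suc n)
  then interpret group G by simp
  have "(\<Union>h\<in>lower_central G n. \<Union>k\<in>carrier G. {h \<otimes>\<^bsub>G\<^esub> k \<otimes>\<^bsub>G\<^esub> inv\<^bsub>G\<^esub> h \<otimes>\<^bsub>G\<^esub> inv\<^bsub>G\<^esub> k}) \<subseteq> carrier G"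
    using Suc by auto
  then show ?case by (auto simp: commutator_subgroup_def intro: generate_in_carrier)
qed simp

lemma commutator_in_lower_central:
  assumes "h \<in> lower_central G n" "k \<in> carrier G"
  shows "h \<otimes>\<^bsub>G\<^esub> k \<otimes>\<^bsub>G\<^esub> inv\<^bsub>G\<^esub> h \<otimes>\<^bsub>G\<^esub> inv\<^bsub>G\<^esub> k \<in> lower_central G (Suc n)"
  using assms by (auto simp: commutator_subgroup_def intro!: generate.incl)

lemma pow_FG: "g \<in> FG \<Longrightarrow> g [^]\<^bsub>FG_group\<^esub> (n::nat) = g ^^ n"
proof (induction n)
  case 0
  then show ?case by (simp add: one_FG)
next
  case (Suc n)
  have "g [^]\<^bsub>FG_group\<^esub> n \<in> FG"
    using monoid.nat_pow_closed[OF group.is_monoid[OF group_FG_group], of g n] Suc.prems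
    by (simp add: carrier_FG)
  then have "g [^]\<^bsub>FG_group\<^esub> Suc n = g ^^ n \<circ> g"
    using Suc by (simp add: mult_FG)
  then show ?case by (simp add: funpow_swap1 fun_eq_iff)
qed

text \<open>The odometer permutes the first level cyclically, so 3 divides the order; and the section of its
  cube at \<open>1\<close> is the odometer itself, so a third of the order would be an order as well.\<close>

lemma odometer_infinite_order:
  assumes "n > 0"
  shows "(rot 1 \<circ> spin 0 1) ^^ n \<noteq> id"
  using assms
proof (induction n rule: less_induct)
  case (less n)
  define z where "z = rot 1 \<circ> spin 0 1"
  have z: "z (x # w) = (x + 1) # (if x = 0 then rot 1 w else if x = 1 then w else spin 0 1 w)" for x w
    by (simp add: z_def)
  show ?case unfolding z_def[symmetric]
  proof
    assume id: "z ^^ n = id"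
    have first: "hd ((z ^^ k) (0 # w)) = of_nat k \<and> (z ^^ k) (0 # w) \<noteq> []" for k w
    proof (induction k)
      case (Suc k)
      then obtain u where "(z ^^ k) (0 # w) = of_nat k # u" by (metis list.collapse)
      then show ?case by (simp add: z add.commute)
    qed simp
    from id have "of_nat n = (0::3)" using first[of n "[]"] by simp
    moreover have "of_nat n = (of_nat (n mod 3) :: 3)"
    proof -
      have three: "of_nat 3 = (0::3)" by simp
      have "(of_nat n :: 3) = of_nat (3 * (n div 3) + n mod 3)" by simp
      also have "\<dots> = of_nat (n mod 3)" using three by (simp only: of_nat_add of_nat_mult) simp
      finally show ?thesis .
    qed
    moreover have "n mod 3 = 0 \<or> n mod 3 = 1 \<or> n mod 3 = 2" by auto
    ultimately have "n mod 3 = 0" by auto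
    then obtain k where k: "n = 3 * k" by (metis mod_0_imp_dvd dvd_def)
    have step: "(z ^^ 3) (1 # w) = 1 # z w" for w
      by (simp add: numeral_3_eq_3 z) (simp add: z_def)
    have "((z ^^ 3) ^^ m) (1 # w) = 1 # (z ^^ m) w" for m w
      by (induction m) (simp_all add: step)
    then have "(z ^^ n) (1 # w) = 1 # (z ^^ k) w" for w
      unfolding k funpow_mult .
    with id have "z ^^ k = id" unfolding fun_eq_iff by (metis id_apply list.inject)
    moreover have "k < n" "k > 0" using less.prems k by auto
    ultimately show False using less.IH unfolding z_def by blast
  qed
qed

section \<open>Periodic quotients and locally nilpotent kernels\<close>

text \<open>The finitely generated subgroup \<open>M\<close> of the kernel is generated by commutators of a fixed nontrivial
  \<open>f\<close>; restricting its elements to the vertices below a moved vertex \<open>v\<close> gives all of the derived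
  subgroup, where the lower central series does not reach the identity.\<close>

lemma locally_nilpotent_kernel_contradiction:
  fixes N :: "('n, 'c) monoid_scheme" and P :: "('p, 'd) monoid_scheme"
  assumes exact: "short_exact_sequence N i FG_group p P" and nilp: "locally_nilpotent_group N"
    and per: "periodic_group P"
  shows False
proof -
  have "group N" "group P" and i: "i \<in> mon N FG_group" and p: "p \<in> epi FG_group P"
    and ker: "i ` carrier N = kernel FG_group P p"
    using exact by (auto simp: short_exact_sequence_def)
  interpret N: group N by fact
  interpret P: group P by fact
  interpret F: group FG_group by (rule group_FG_group)
  interpret i: group_hom N FG_group i
    using i by unfold_locales (auto simp: mon_def)
  interpret p: group_hom FG_group P p
    using p by unfold_locales (auto simp: epi_def)
  have iFG: "i y \<in> FG" if "y \<in> carrier N" for y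
    using i.hom_closed[OF that] by (simp add: carrier_FG)
  have i_mult: "i (y \<otimes>\<^bsub>N\<^esub> y') = i y \<circ> i y'" if "y \<in> carrier N" "y' \<in> carrier N" for y y'
    using that by (simp add: mult_FG iFG)
  have i_one: "i \<one>\<^bsub>N\<^esub> = id"
    using i.hom_one by (simp add: one_FG)
  have p_mult: "p (g \<circ> h) = p g \<otimes>\<^bsub>P\<^esub> p h" if "g \<in> FG" "h \<in> FG" for g h
    using p.hom_mult[of g h] that by (simp add: carrier_FG mult_FG)
  have p_carrier: "p g \<in> carrier P" if "g \<in> FG" for g
    using p.hom_closed[of g] that by (simp add: carrier_FG)
  have p_id: "p id = \<one>\<^bsub>P\<^esub>"
    using p.hom_one by (simp add: one_FG)

  define z where "z = rot 1 \<circ> spin 0 1"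
  have z: "z \<in> FG" unfolding z_def by (intro comp_in_FG rot_in_FG spin_in_FG)
  obtain n :: nat where n: "n > 0" "p z [^]\<^bsub>P\<^esub> n = \<one>\<^bsub>P\<^esub>"
    using per p_carrier[OF z] by (auto simp: periodic_group_def)
  define f where "f = z ^^ n"
  have f_pow: "f = z [^]\<^bsub>FG_group\<^esub> n" by (simp add: f_def pow_FG z)
  have f: "f \<in> FG"
    using F.nat_pow_closed[of z n] z by (simp add: f_pow carrier_FG)
  have pf: "p f = \<one>\<^bsub>P\<^esub>"
    using p.hom_nat_pow[of z n] z n by (simp add: f_pow carrier_FG)
  have "f \<noteq> id" using odometer_infinite_order[OF n(1)] by (simp add: f_def z_def del: comp_apply)
  then obtain v where v: "f v \<noteq> v" by (auto simp: fun_eq_iff)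
  obtain f' where f': "f' \<in> FG" "f' \<circ> f = id" "f \<circ> f' = id" using FG_inverse[OF f] by blast
  have pf': "p f' = \<one>\<^bsub>P\<^esub>"
    using p_mult[OF f'(1) f] p_carrier[OF f'(1)] f'(2) pf p_id by simp

  \<comment> \<open>The commutators with the generators of the derived subgroup placed below \<open>v\<close>: a finite family.\<close>
  let ?gen = "\<lambda>(a, b, c). spin a b \<circ> spin c (- b)"
  let ?gen' = "\<lambda>(a, b, c). spin c b \<circ> spin a (- b)"
  let ?comm = "\<lambda>t. f \<circ> (below v (?gen t) \<circ> (f' \<circ> below v (?gen' t)))"
  have gen_inv: "?gen t \<circ> ?gen' t = id" for t
    by (cases t) (simp add: fun_eq_iff spin_spin spin_0)
  have comm_ker: "?comm t \<in> i ` carrier N" for t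
  proof -
    obtain a b c where t: "t = (a, b, c)" by (cases t)
    have b: "below v (?gen t) \<in> FG" "below v (?gen' t) \<in> FG"
      by (auto simp: t simp del: comp_apply intro!: FG_derived_in_FG below_in_FG_derived FG_derived_gen)
    have "?comm t \<in> FG" by (intro comp_in_FG f f' b)
    moreover have "p (?comm t) = p (below v (?gen t) \<circ> below v (?gen' t))"
      using b f f' by (simp add: p_mult comp_in_FG pf pf' p_carrier del: comp_apply)
    then have "p (?comm t) = \<one>\<^bsub>P\<^esub>"
      by (simp add: below_inverse[OF gen_inv] p_id del: comp_apply id_apply)
    ultimately show ?thesis
      by (simp add: ker kernel_def carrier_FG del: comp_apply)
  qed
  have "finite (range ?comm)" by (intro finite_imageI) (simp add: finite_prod UNIV_alphabet)
  moreover have "range ?comm \<subseteq> i ` carrier N" using comm_ker by blast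
  ultimately obtain S where S: "S \<subseteq> carrier N" "finite S" "range ?comm = i ` S"
    by (meson finite_subset_image)

  let ?M = "subgroup_generated N S"
  interpret M: group ?M by (rule N.group_subgroup_generated)
  have M_N: "y \<in> carrier N" if "y \<in> carrier ?M" for y
    using that S N.carrier_subgroup_generated_subset by blast
  \<comment> \<open>The homomorphism from the generated subgroup to its sections at \<open>v\<close>, written as a relation.\<close>
  define acts where "acts y h \<longleftrightarrow> (\<forall>u. i y (v @ u) = v @ h u)" for y h
  have acts_mult: "acts (y \<otimes>\<^bsub>?M\<^esub> y') (h \<circ> h')"
    if "y \<in> carrier ?M" "y' \<in> carrier ?M" "acts y h" "acts y' h'" for y y' h h'
    using that i_mult[OF M_N[OF that(1)] M_N[OF that(2)]] by (simp add: acts_def del: i.hom_mult)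
  have acts_inv: "acts (inv\<^bsub>?M\<^esub> y) h'" if y: "y \<in> carrier ?M" "acts y h" "h \<circ> h' = id" for y h h'
    unfolding acts_def
  proof
    fix u
    have "i (inv\<^bsub>?M\<^esub> y) \<circ> i y = id"
      using M.l_inv[OF y(1)] i_mult[of "inv\<^bsub>?M\<^esub> y" y] i_one M_N[OF y(1)] M_N[OF M.inv_closed[OF y(1)]]
      by simp
    then have "i (inv\<^bsub>?M\<^esub> y) (i y (v @ h' u)) = v @ h' u"
      by (metis comp_apply id_apply)
    moreover have "i y (v @ h' u) = v @ u"
      using y(2,3) by (metis acts_def comp_apply id_apply)
    ultimately show "i (inv\<^bsub>?M\<^esub> y) (v @ u) = v @ h' u" by simp
  qed
  have acts_ex: "\<exists>y\<in>carrier ?M. acts y h" if "h \<in> FG_derived" for h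
    using that
  proof (induction rule: FG_derived.induct)
    case id
    have "acts \<one>\<^bsub>?M\<^esub> id" by (simp add: acts_def one_FG)
    then show ?case using M.one_closed by blast
  next
    case (comp h a b c)
    then obtain y where y: "y \<in> carrier ?M" "acts y h" by blast
    have "?comm (c, b, a) \<in> i ` S" unfolding S(3)[symmetric] by (rule rangeI)
    then obtain s where s: "?comm (c, b, a) = i s" "s \<in> S" by (rule imageE)
    have "s \<in> carrier ?M"
      unfolding carrier_subgroup_generated using s(2) S(1) by (intro generate.incl) blast
    moreover have "acts s (spin a b \<circ> spin c (- b))"
    proof -
      have "i s (v @ u) = v @ (?gen' (c, b, a)) u" for u
        using commutator_below[OF f'(1) f'(3) v, of "?gen (c, b, a)" "?gen' (c, b, a)" u]
        unfolding s(1)[symmetric] comp_apply .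
      then show ?thesis unfolding acts_def split_conv by blast
    qed
    ultimately have "acts (s \<otimes>\<^bsub>?M\<^esub> y) (spin a b \<circ> spin c (- b) \<circ> h)"
      using y by (intro acts_mult)
    then show ?case
      using M.m_closed[OF \<open>s \<in> carrier ?M\<close> y(1)] unfolding comp_assoc by blast
  qed

  have key: "\<exists>y\<in>lower_central ?M n. \<exists>h\<in>FG_derived. h \<noteq> id \<and> acts y h" for n
  proof (induction n)
    case 0
    have "(spin 0 1 \<circ> spin 1 (- 1)) [0, 0] \<noteq> id [0, 0]" by simp
    then have "spin 0 1 \<circ> spin 1 (- 1) \<noteq> id" by metis
    moreover have "spin 0 1 \<circ> spin 1 (- 1) \<in> FG_derived" by (rule FG_derived_gen)
    ultimately show ?case using acts_ex by fastforce
  next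
    case (Suc n)
    then obtain y h where y: "y \<in> lower_central ?M n" and h: "h \<in> FG_derived" "h \<noteq> id" "acts y h"
      by blast
    have yM: "y \<in> carrier ?M" using y lower_central_in_carrier[OF M.group_axioms] by blast
    obtain u where u: "h u \<noteq> u" using h(2) by (auto simp: fun_eq_iff)
    obtain h' where h': "h' \<in> FG_derived" "h \<circ> h' = id" using FG_derived_inverse[OF h(1)] by blast
    \<comment> \<open>A commutator with an element placed below a vertex moved by \<open>h\<close> cannot vanish.\<close>
    let ?d = "spin 0 1 \<circ> spin 1 (- 1)"
    let ?d' = "spin 1 1 \<circ> spin 0 (- 1)"
    have dd': "?d \<circ> ?d' = id" by (simp add: fun_eq_iff spin_spin spin_0)
    let ?k = "below u ?d" and ?k' = "below u ?d'"
    have k: "?k \<in> FG_derived" "?k' \<in> FG_derived" by (intro below_in_FG_derived FG_derived_gen)+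
    obtain y0 where y0: "y0 \<in> carrier ?M" "acts y0 ?k" using acts_ex[OF k(1)] by blast
    let ?y = "y \<otimes>\<^bsub>?M\<^esub> y0 \<otimes>\<^bsub>?M\<^esub> inv\<^bsub>?M\<^esub> y \<otimes>\<^bsub>?M\<^esub> inv\<^bsub>?M\<^esub> y0"
    let ?h = "h \<circ> ?k \<circ> h' \<circ> ?k'"
    have "?y \<in> lower_central ?M (Suc n)" by (rule commutator_in_lower_central[OF y y0(1)])
    moreover have "?h \<in> FG_derived" by (intro FG_derived_comp h h' k)
    moreover have "?h \<noteq> id"
    proof
      assume "?h = id"
      then have "?h (u @ [0, 0]) = u @ [0, 0]" by simp
      moreover have "?h (u @ [0, 0]) = u @ ?d' [0, 0]"
        using commutator_below[OF FG_derived_in_FG[OF h'(1)] h'(2) u, of ?d ?d' "[0, 0]"] by simp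
      ultimately show False by simp
    qed
    moreover have "acts ?y ?h"
      using yM y0 h(3) acts_inv[OF yM h(3) h'(2)] acts_inv[OF y0 below_inverse[OF dd']]
      by (intro acts_mult M.m_closed M.inv_closed)
    ultimately show ?case by blast
  qed

  obtain m where m: "lower_central ?M m = {\<one>\<^bsub>?M\<^esub>}"
    using nilp S by (auto simp: locally_nilpotent_group_def nilpotent_group_def)
  then obtain h where h: "h \<noteq> id" "acts \<one>\<^bsub>?M\<^esub> h" using key[of m] by auto
  then have "h u = u" for u by (simp add: acts_def one_FG)
  with h(1) show False by (auto simp: fun_eq_iff)
qed

section \<open>Lengths of sections and tight words\<close>

definition len :: "(3 list \<Rightarrow> 3 list) \<Rightarrow> nat" where
  "len g = (LEAST n. \<exists>w c. length w = n \<and> g = elt w c)"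

text \<open>What the length and the total lengths of sections on any level have in common. A function with these
  properties is bounded by the number of letters of any word representing the element.\<close>

definition length_like :: "((3 list \<Rightarrow> 3 list) \<Rightarrow> nat) \<Rightarrow> bool" where
  "length_like \<nu> \<longleftrightarrow> (\<forall>g\<in>FG. \<forall>h\<in>FG. \<nu> (g \<circ> h) \<le> \<nu> g + \<nu> h) \<and>
     (\<forall>c. \<nu> (rot c) = 0) \<and> (\<forall>i f. \<nu> (spin i f) \<le> 1)"

definition secsum :: "((3 list \<Rightarrow> 3 list) \<Rightarrow> nat) \<Rightarrow> (3 list \<Rightarrow> 3 list) \<Rightarrow> nat" where
  "secsum \<nu> g = (\<Sum>x\<in>UNIV. \<nu> (sec g x))"

lemma len_le: "len (elt w c) \<le> length w"
  unfolding len_def by (rule Least_le) blast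

lemma len_word:
  assumes "g \<in> FG"
  obtains w c where "g = elt w c" "length w = len g"
proof -
  from assms obtain w c where "g = elt w c" by (rule FG_cases)
  then have "\<exists>n w c. length w = n \<and> g = elt w c" by blast
  then have "\<exists>w c. length w = len g \<and> g = elt w c" unfolding len_def by (rule LeastI_ex)
  with that show ?thesis by blast
qed

lemma length_like_len: "length_like len"
  unfolding length_like_def
proof (intro conjI ballI allI)
  fix g h assume "g \<in> FG" "h \<in> FG"
  then obtain u c v d where "g = elt u c" "length u = len g" "h = elt v d" "length v = len h"
    by (metis len_word)
  then show "len (g \<circ> h) \<le> len g + len h"
    using len_le[of "u @ map (\<lambda>(i, f). (i + c, f)) v" "c + d"] elt_comp[of u c v d]
    by (simp del: comp_apply)
next
  show "len (rot c) = 0" for c using len_le[of "[]" c] by simp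
  show "len (spin i f) \<le> 1" for i f using len_le[of "[(i, f)]" 0] unfolding spin_eq_elt by simp
qed

lemma
  assumes "length_like \<nu>"
  shows length_like_comp: "g \<in> FG \<Longrightarrow> h \<in> FG \<Longrightarrow> \<nu> (g \<circ> h) \<le> \<nu> g + \<nu> h"
    and length_like_rot: "\<nu> (rot c) = 0"
    and length_like_spin: "\<nu> (spin i f) \<le> 1"
    and length_like_id: "\<nu> id = 0"
  using assms unfolding length_like_def by (blast, blast, blast, metis rot_0)

text \<open>The first level action of \<open>h\<close> only permutes the sections of \<open>g\<close> in the section formula for \<open>g \<circ> h\<close>, and only
  one of the three sections of a letter can have positive length.\<close>

lemma length_like_secsum:
  assumes "length_like \<nu>"
  shows "length_like (secsum \<nu>)"
  unfolding length_like_def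
proof (intro conjI ballI allI)
  fix g h assume g: "g \<in> FG" and h: "h \<in> FG"
  obtain c d where cd: "shifts g c" "shifts h d" using FG_shifts g h by blast
  have "secsum \<nu> (g \<circ> h) = (\<Sum>x\<in>UNIV. \<nu> (sec g (x + d) \<circ> sec h x))"
    by (simp add: secsum_def shifts_comp(2)[OF cd])
  also have "\<dots> \<le> (\<Sum>x\<in>UNIV. \<nu> (sec g (x + d)) + \<nu> (sec h x))"
    by (intro sum_mono length_like_comp assms sec_in_FG g h)
  also have "\<dots> = (\<Sum>x\<in>UNIV. \<nu> (sec g (x + d))) + secsum \<nu> h"
    by (simp add: sum.distrib secsum_def)
  also have "(\<Sum>x\<in>UNIV. \<nu> (sec g (x + d))) = secsum \<nu> g"
    unfolding secsum_def by (rule sum.reindex_bij_witness[of _ "\<lambda>x. x - d" "\<lambda>x. x + d"]) auto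
  finally show "secsum \<nu> (g \<circ> h) \<le> secsum \<nu> g + secsum \<nu> h" .
next
  show "secsum \<nu> (rot c) = 0" for c
    by (simp add: secsum_def sec_rot length_like_id[OF assms] del: id_apply)
  show "secsum \<nu> (spin i f) \<le> 1" for i f
    using length_like_spin[OF assms, of 0 f] length_like_rot[OF assms, of f] length_like_id[OF assms]
    unfolding secsum_def sum_alphabet[of _ i] by (simp add: sec_spin del: id_apply)
qed

lemma length_like_elt: "length_like \<nu> \<Longrightarrow> \<nu> (elt w c) \<le> length w"
proof (induction w)
  case (Cons l w)
  then show ?case
    using length_like_comp[OF Cons.prems spin_in_FG elt_in_FG, of "fst l" "snd l" w c]
      length_like_spin[OF Cons.prems, of "fst l" "snd l"] by (simp del: comp_apply)
qed (simp add: length_like_rot)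

lemma length_like_rot_comp:
  "length_like \<nu> \<Longrightarrow> h \<in> FG \<Longrightarrow> \<nu> h \<le> n \<Longrightarrow> \<nu> (rot c \<circ> h) \<le> n"
  using length_like_comp[of \<nu> "rot c" h] length_like_rot[of \<nu> c] by (simp del: comp_apply)

lemma length_like_spin_comp:
  "length_like \<nu> \<Longrightarrow> h \<in> FG \<Longrightarrow> \<nu> h \<le> n \<Longrightarrow> \<nu> (spin i f \<circ> h) \<le> Suc n"
  using length_like_comp[of \<nu> "spin i f" h] length_like_spin[of \<nu> i f] by (simp del: comp_apply)

lemma length_like_rot_le: "length_like \<nu> \<Longrightarrow> \<nu> (rot c) \<le> n"
  by (simp add: length_like_rot)

lemma length_like_spin_le: "length_like \<nu> \<Longrightarrow> \<nu> (spin i f) \<le> Suc n"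
  using length_like_spin[of \<nu> i f] by simp

lemmas length_like_bounds =
  length_like_rot_le length_like_spin_le length_like_rot_comp length_like_spin_comp

lemma sec_spin_simps:
  "sec (spin i f) i = rot f" "sec (spin i f) (i + 1) = id" "sec (spin i f) (i + 2) = spin 0 f"
  "sec (spin (i + 1) f) i = spin 0 f" "sec (spin (i + 1) f) (i + 1) = rot f"
  "sec (spin (i + 1) f) (i + 2) = id"
  "sec (spin (i + 2) f) i = id" "sec (spin (i + 2) f) (i + 1) = spin 0 f"
  "sec (spin (i + 2) f) (i + 2) = rot f"
  by (simp_all add: sec_spin)

text \<open>At the vertex \<open>i + 2\<close> the middle letter has trivial section, so the two outer powers of \<open>t\<close> merge
  and one letter is lost.\<close>

lemma secsum_turn:
  assumes "length_like \<nu>"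
  shows "secsum \<nu> (spin i f \<circ> (spin (i + 1) f' \<circ> spin i f'')) \<le> 2"
proof -
  let ?g = "spin i f \<circ> (spin (i + 1) f' \<circ> spin i f'')"
  note bounds = length_like_bounds[OF assms] comp_in_FG rot_in_FG spin_in_FG
  have sec: "sec ?g x = sec (spin i f) x \<circ> (sec (spin (i + 1) f') x \<circ> sec (spin i f'') x)" for x
    using shifts_comp[OF shifts_spin shifts_spin, of "i + 1" f' i f'']
    by (simp add: shifts_comp(2)[OF shifts_spin] del: comp_apply)
  have "sec ?g i = rot f \<circ> (spin 0 f' \<circ> rot f'')"
    by (simp only: sec sec_spin_simps id_comp comp_id)
  then have 1: "\<nu> (sec ?g i) \<le> Suc 0"
    by (simp only:) (intro bounds)
  have "sec ?g (i + 1) = rot f'"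
    by (simp only: sec sec_spin_simps id_comp comp_id)
  then have 2: "\<nu> (sec ?g (i + 1)) \<le> 0"
    by (simp only:) (intro bounds)
  have "sec ?g (i + 2) = spin 0 (f + f'')"
    by (simp only: sec sec_spin_simps id_comp comp_id spin_comp)
  then have 3: "\<nu> (sec ?g (i + 2)) \<le> Suc 0"
    by (simp only:) (intro bounds)
  show ?thesis
    unfolding secsum_def sum_alphabet[of _ i] using 1 2 3 by simp
qed

definition len2 :: "(3 list \<Rightarrow> 3 list) \<Rightarrow> nat" where
  "len2 = secsum (secsum len)"

text \<open>Passing to the second level loses nothing of the length of the word.\<close>

definition tight :: "(3 \<times> 3) list \<Rightarrow> bool" where
  "tight w \<longleftrightarrow> length w \<le> len2 (elt w 0)"

lemma length_like_len2: "length_like len2"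
  unfolding len2_def by (intro length_like_secsum length_like_len)

lemma len2_append: "len2 (elt (u @ v) c) \<le> len2 (elt u 0) + len2 (elt v c)"
  unfolding elt_append by (rule length_like_comp[OF length_like_len2 elt_in_FG elt_in_FG])

text \<open>By subadditivity, a loss in a subword is a loss in the whole word.\<close>

lemma tight_infix:
  assumes "tight (u @ v @ s)"
  shows "tight v"
  using assms len2_append[of u "v @ s" 0] len2_append[of v s 0]
    length_like_elt[OF length_like_len2, of u 0] length_like_elt[OF length_like_len2, of s 0]
  by (simp add: tight_def)

lemma tight_window:
  assumes "tight w" "k + n \<le> length w"
  shows "tight (map (\<lambda>j. w ! (k + j)) [0..<n])"
proof -
  have "map (\<lambda>j. w ! (k + j)) [0..<n] = take n (drop k w)"
    using assms(2) by (auto intro!: nth_equalityI)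
  moreover have "w = take k w @ take n (drop k w) @ drop n (drop k w)"
    by (simp only: append_take_drop_id)
  ultimately show ?thesis using assms(1) tight_infix by metis
qed

lemma not_tight_trivial: "\<not> tight [(i, 0)]"
  by (simp add: tight_def spin_0 length_like_rot[OF length_like_len2] del: id_apply)

lemma not_tight_repeat: "\<not> tight [(i, f), (i, f')]"
proof -
  have "elt [(i, f), (i, f')] 0 = elt [(i, f + f')] 0"
    by (simp add: spin_spin fun_eq_iff)
  then show ?thesis
    using length_like_elt[OF length_like_len2, of "[(i, f + f')]" 0] by (simp add: tight_def del: elt.simps)
qed

lemma not_tight_turn: "\<not> tight [(i, f), (i + 1, f'), (i, f'')]"
  using secsum_turn[OF length_like_secsum[OF length_like_len], of i f f' f'']
  by (simp add: tight_def len2_def rot_0 del: comp_apply id_apply)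

lemma len2_window:
  assumes "secsum len (sec g i) \<le> 2" "secsum len (sec g (i + 1)) \<le> 2" "secsum len (sec g (i + 2)) \<le> 2"
  shows "len2 g \<le> 6"
  using assms unfolding len2_def secsum_def[of "secsum len"] sum_alphabet[of _ i] by simp

text \<open>Conjugating the middle letter by the rotation produces a turn of indices \<open>0, 1, 0\<close>.\<close>

lemma secsum_sections_turn:
  assumes "length_like \<nu>"
  shows "secsum \<nu> (spin 0 f \<circ> (rot 1 \<circ> (spin 0 f' \<circ> (rot 2 \<circ> spin 0 f'')))) \<le> 2"
proof -
  have "spin 0 f \<circ> (rot 1 \<circ> (spin 0 f' \<circ> (rot 2 \<circ> spin 0 f''))) =
      spin 0 f \<circ> (spin (0 + 1) f' \<circ> spin 0 f'')"
  proof -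
    have three: "(3::3) = 0" by simp
    have "rot 1 (spin 0 f' (rot 2 (spin 0 f'' w))) = spin 1 f' (spin 0 f'' w)" for w
      using fun_cong[OF rot_spin[of 1 0 f'], of "rot 2 (spin 0 f'' w)"] rot_rot[of 1 2]
      by (simp add: rot_rot[of 1 2] rot_0 three)
    then show ?thesis by (simp add: fun_eq_iff)
  qed
  then show ?thesis using secsum_turn[OF assms, of 0 f f' f''] by (simp del: comp_apply)
qed

lemma sec_elt_0: "sec (elt ((i, f) # w) 0) x = sec (spin i f) x \<circ> sec (elt w 0) x"
  using sec_elt_Cons[of "(i, f)" w 0 x] by (simp del: comp_apply)

lemma sec_elt_Nil: "sec (elt [] 0) x = id"
  by (simp add: sec_rot del: id_apply)

text \<open>Seven letters suffice for a turn on the second level: the section at \<open>i + 2\<close> involves three powers of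
  \<open>t\<close>, separated by the rotations coming from the letters with index \<open>i + 2\<close>; the exponents
  \<open>1\<close> and \<open>2\<close> make these rotations a step up followed by a step down.\<close>

lemma not_tight_ascending:
  "\<not> tight [(i, f1), (i + 1, f2), (i + 2, 1), (i, f4), (i + 1, f5), (i + 2, 2), (i, f7)]"
proof -
  let ?g = "elt [(i, f1), (i + 1, f2), (i + 2, 1), (i, f4), (i + 1, f5), (i + 2, 2), (i, f7)] 0"
  note bounds = length_like_bounds[OF length_like_secsum[OF length_like_len]] comp_in_FG rot_in_FG spin_in_FG
  have "len2 ?g \<le> 6"
  proof (rule len2_window)
    have "sec ?g i = rot f1 \<circ> (spin 0 f2 \<circ> (rot f4 \<circ> (spin 0 f5 \<circ> rot f7)))"
      by (simp only: sec_elt_0 sec_elt_Nil sec_spin_simps id_comp comp_id)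
    moreover have "secsum len (rot f1 \<circ> (spin 0 f2 \<circ> (rot f4 \<circ> (spin 0 f5 \<circ> rot f7)))) \<le> Suc (Suc 0)"
      by (intro bounds)
    ultimately show "secsum len (sec ?g i) \<le> 2" by (simp del: elt.simps comp_apply)
    have "sec ?g (i + 1) = rot f2 \<circ> (spin 0 1 \<circ> (rot f5 \<circ> spin 0 2))"
      by (simp only: sec_elt_0 sec_elt_Nil sec_spin_simps id_comp comp_id)
    moreover have "secsum len (rot f2 \<circ> (spin 0 1 \<circ> (rot f5 \<circ> spin 0 2))) \<le> Suc (Suc 0)"
      by (intro bounds)
    ultimately show "secsum len (sec ?g (i + 1)) \<le> 2" by (simp del: elt.simps comp_apply)
    have "sec ?g (i + 2) = spin 0 f1 \<circ> (rot 1 \<circ> (spin 0 f4 \<circ> (rot 2 \<circ> spin 0 f7)))"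
      by (simp only: sec_elt_0 sec_elt_Nil sec_spin_simps id_comp comp_id)
    then show "secsum len (sec ?g (i + 2)) \<le> 2"
      using secsum_sections_turn[OF length_like_len] by (simp del: elt.simps comp_apply)
  qed
  then show ?thesis unfolding tight_def by simp
qed

text \<open>The mirror image: with descending indices, the letters with index \<open>i + 2\<close> are the second and the fifth.\<close>

lemma not_tight_descending:
  "\<not> tight [(i, f1), (i + 2, 1), (i + 1, f3), (i, f4), (i + 2, 2), (i + 1, f6), (i, f7)]"
proof -
  let ?g = "elt [(i, f1), (i + 2, 1), (i + 1, f3), (i, f4), (i + 2, 2), (i + 1, f6), (i, f7)] 0"
  note bounds = length_like_bounds[OF length_like_secsum[OF length_like_len]] comp_in_FG rot_in_FG spin_in_FG
  have "len2 ?g \<le> 6"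
  proof (rule len2_window)
    have "sec ?g i = rot f1 \<circ> (spin 0 f3 \<circ> (rot f4 \<circ> (spin 0 f6 \<circ> rot f7)))"
      by (simp only: sec_elt_0 sec_elt_Nil sec_spin_simps id_comp comp_id)
    moreover have "secsum len (rot f1 \<circ> (spin 0 f3 \<circ> (rot f4 \<circ> (spin 0 f6 \<circ> rot f7)))) \<le> Suc (Suc 0)"
      by (intro bounds)
    ultimately show "secsum len (sec ?g i) \<le> 2" by (simp del: elt.simps comp_apply)
    have "sec ?g (i + 1) = spin 0 1 \<circ> (rot f3 \<circ> (spin 0 2 \<circ> rot f6))"
      by (simp only: sec_elt_0 sec_elt_Nil sec_spin_simps id_comp comp_id)
    moreover have "secsum len (spin 0 1 \<circ> (rot f3 \<circ> (spin 0 2 \<circ> rot f6))) \<le> Suc (Suc 0)"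
      by (intro bounds)
    ultimately show "secsum len (sec ?g (i + 1)) \<le> 2" by (simp del: elt.simps comp_apply)
    have "sec ?g (i + 2) = spin 0 f1 \<circ> (rot 1 \<circ> (spin 0 f4 \<circ> (rot 2 \<circ> spin 0 f7)))"
      by (simp only: sec_elt_0 sec_elt_Nil sec_spin_simps id_comp comp_id)
    then show "secsum len (sec ?g (i + 2)) \<le> 2"
      using secsum_sections_turn[OF length_like_len] by (simp del: elt.simps comp_apply)
  qed
  then show ?thesis unfolding tight_def by simp
qed

section \<open>Counting tight words\<close>

definition threshold :: "nat list \<Rightarrow> nat \<Rightarrow> 3" where
  "threshold xs k = (if xs ! (k mod 3) \<le> k then 1 else 2)"

text \<open>A condition that propagates from \<open>k\<close> to \<open>k + 3\<close> is determined, on each residue class modulo 3, by the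
  place where it first holds. The value \<open>M\<close> beyond the interval stands for a class in which it never holds.\<close>

lemma threshold_code:
  fixes F :: "nat \<Rightarrow> 3"
  assumes vals: "\<And>k. s \<le> k \<Longrightarrow> k \<le> e \<Longrightarrow> F k = 1 \<or> F k = 2"
    and up: "\<And>k. s \<le> k \<Longrightarrow> k + 3 \<le> e \<Longrightarrow> F k = 1 \<Longrightarrow> F (k + 3) = 1"
    and "e < M"
  obtains xs where "length xs = 3" "set xs \<subseteq> {..M}"
    "\<And>k. s \<le> k \<Longrightarrow> k \<le> e \<Longrightarrow> F k = threshold xs k"
proof -
  define P where "P r k \<longleftrightarrow> s \<le> k \<and> k \<le> e \<and> k mod 3 = r \<and> F k = 1" for r k
  define t where "t r = (if \<exists>k. P r k then LEAST k. P r k else M)" for r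
  define xs where "xs = map t [0..<3]"
  have least: "P r (t r) \<and> t r \<le> k" if "P r k" for r k
  proof -
    have "t r = (LEAST k. P r k)" using that by (auto simp: t_def)
    then show ?thesis using that LeastI[of "P r" k] Least_le[of "P r" k] by simp
  qed
  have run: "F (m + 3 * d) = 1" if "P r m" "m + 3 * d \<le> e" for r m d
    using that(2)
  proof (induction d)
    case (Suc d)
    then show ?case using up[of "m + 3 * d"] that(1) by (simp add: P_def add_ac)
  qed (use that in \<open>simp add: P_def\<close>)
  have "F k = threshold xs k" if k: "s \<le> k" "k \<le> e" for k
  proof (cases "F k = 1")
    case True
    then have "P (k mod 3) k" using k by (simp add: P_def)
    then have "t (k mod 3) \<le> k" using least by blast
    then show ?thesis using True by (simp add: threshold_def xs_def)
  next
    case False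
    have "\<not> t (k mod 3) \<le> k"
    proof
      assume le: "t (k mod 3) \<le> k"
      then have "\<exists>m. P (k mod 3) m" using \<open>e < M\<close> k by (cases "\<exists>m. P (k mod 3) m") (auto simp: t_def)
      then have P: "P (k mod 3) (t (k mod 3))" using least by blast
      then have "t (k mod 3) mod 3 = k mod 3" by (simp add: P_def)
      then have "3 dvd k - t (k mod 3)" using le by (metis mod_eq_dvd_iff_nat)
      then obtain d where "k = t (k mod 3) + 3 * d" using le by (metis dvdE le_add_diff_inverse)
      then show False using run[OF P, of d] k False by simp
    qed
    moreover have "F k = 2" using vals k False by blast
    ultimately show ?thesis by (simp add: threshold_def xs_def)
  qed
  moreover have "t r \<le> M" for r
  proof (cases "\<exists>k. P r k")
    case True
    then obtain k where "P r k" by blast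
    then have "t r \<le> k" "k \<le> e" using least by (auto simp: P_def)
    then show ?thesis using \<open>e < M\<close> by simp
  qed (simp add: t_def)
  ultimately show ?thesis by (intro that[of xs]) (auto simp: xs_def)
qed

text \<open>The indices descend up to position \<open>p\<close> and ascend afterwards; a step down is the translation by \<open>2\<close>.
  The exponents are given by thresholds inside the two stretches. The windows of seven letters
  that force monotonicity do not fit around the ends of the word and the turning point; the
  exponents at the five positions \<open>0\<close>, \<open>p - 1\<close>, \<open>p\<close>, \<open>p + 1\<close>, \<open>L - 1\<close> are listed separately in \<open>es\<close>.\<close>

definition tight_code :: "nat \<Rightarrow> 3 \<Rightarrow> nat \<Rightarrow> nat list \<Rightarrow> nat list \<Rightarrow> 3 list \<Rightarrow> (3 \<times> 3) list" where
  "tight_code L i p xs ys es = map (\<lambda>k. (i + of_nat (2 * min k p + (k - p)),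
     if k = 0 then es ! 0 else if k + 1 < p then threshold xs k else if k < p + 2 then es ! (k + 2 - p)
     else if k + 1 < L then threshold ys k else es ! 4)) [0..<L]"

text \<open>Each restriction comes from a forbidden short subword: trivial letters, repeated indices, turns from
  ascent to descent, and the two windows of seven letters.\<close>

lemma tight_word_is_coded:
  assumes "tight w" "length w = L" "L > 0"
  obtains i p xs ys es where "w = tight_code L i p xs ys es" "p < L"
    "length xs = 3" "set xs \<subseteq> {..L}" "length ys = 3" "set ys \<subseteq> {..L}" "length es = 5"
proof -
  define I where "I k = fst (w ! k)" for k
  define F where "F k = snd (w ! k)" for k
  have w: "w ! k = (I k, F k)" for k by (simp add: I_def F_def)
  have win1: "tight [(I k, F k)]" if "k < L" for k
    using tight_window[OF assms(1), of k 1] that assms(2) by (simp add: w)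
  have win2: "tight [(I k, F k), (I (k + 1), F (k + 1))]" if "k + 1 < L" for k
    using tight_window[OF assms(1), of k 2] that assms(2) by (simp add: w numeral_2_eq_2)
  have win3: "tight [(I k, F k), (I (k + 1), F (k + 1)), (I (k + 2), F (k + 2))]" if "k + 2 < L" for k
    using tight_window[OF assms(1), of k 3] that assms(2) by (simp add: w eval_nat_numeral)
  have win7: "tight [(I k, F k), (I (k + 1), F (k + 1)), (I (k + 2), F (k + 2)), (I (k + 3), F (k + 3)),
      (I (k + 4), F (k + 4)), (I (k + 5), F (k + 5)), (I (k + 6), F (k + 6))]" if "k + 6 < L" for k
    using tight_window[OF assms(1), of k 7] that assms(2) by (simp add: w eval_nat_numeral)
  have F: "F k = 1 \<or> F k = 2" if "k < L" for k
    using win1[OF that] not_tight_trivial alphabet_cases[of "F k"] by metis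
  have step: "I (k + 1) = I k + 1 \<or> I (k + 1) = I k + 2" if "k + 1 < L" for k
  proof -
    have "I (k + 1) \<noteq> I k" using win2[OF that] not_tight_repeat by metis
    then show ?thesis using alphabet_cases[of "I (k + 1) - I k"] by (auto simp: algebra_simps)
  qed
  have no_turn: "I (k + 2) = I (k + 1) + 1" if "k + 2 < L" "I (k + 1) = I k + 1" for k
  proof (rule ccontr)
    assume "I (k + 2) \<noteq> I (k + 1) + 1"
    then have "I (k + 2) = I (k + 1) + 2" using step[of "k + 1"] that(1) by (auto simp: eval_nat_numeral)
    then have "I (k + 2) = I k" using that(2) by simp
    then show False using win3[OF that(1)] that(2) not_tight_turn by metis
  qed
  \<comment> \<open>The position from which the indices ascend.\<close>
  define p where "p = (LEAST k. k + 1 \<ge> L \<or> I (k + 1) = I k + 1)"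
  have p: "p + 1 \<ge> L \<or> I (p + 1) = I p + 1" unfolding p_def
    by (rule LeastI[of _ L]) simp
  have "p \<le> L - 1" unfolding p_def using assms(3) by (intro Least_le) simp
  with \<open>L > 0\<close> have pL: "p < L" by simp
  have down: "I (k + 1) = I k + 2" if "k < p" for k
    using not_less_Least[of k "\<lambda>k. k + 1 \<ge> L \<or> I (k + 1) = I k + 1"] step[of k] that
    unfolding p_def by auto
  have up: "I (k + 1) = I k + 1" if "p \<le> k" "k + 1 < L" for k
    using that
  proof (induction k rule: dec_induct)
    case base
    then show ?case using p by simp
  next
    case (step k)
    then show ?case using no_turn[of k] by simp
  qed
  have I: "I k = I 0 + of_nat (2 * min k p + (k - p))" if "k < L" for k
    using that
  proof (induction k)
    case (Suc k)
    have "2 * min (Suc k) p + (Suc k - p) = 2 * min k p + (k - p) + (if k < p then 2 else 1)"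
      by auto
    then have "I 0 + of_nat (2 * min (Suc k) p + (Suc k - p)) = I k + (if k < p then 2 else 1)"
      using Suc by (simp only: of_nat_add) (simp add: add.assoc)
    also have "\<dots> = I (Suc k)"
      using down[of k] up[of k] Suc.prems by simp
    finally show ?case by (rule sym)
  qed simp
  have asc: "F (k + 3) = 1" if "p + 2 \<le> k" "k + 3 \<le> L - 2" "F k = 1" for k
  proof (rule ccontr)
    assume "F (k + 3) \<noteq> 1"
    then have F2: "F (k + 3) = 2" using F[of "k + 3"] that by simp
    define j where "j = k - 2"
    have j: "k = j + 2" using that by (simp add: j_def)
    have "p \<le> j" "j + 6 < L" using that j by auto
    then have "I (j + 1) = I j + 1" "I (j + 2) = I (j + 1) + 1" "I (j + 3) = I (j + 2) + 1"
      "I (j + 4) = I (j + 3) + 1" "I (j + 5) = I (j + 4) + 1" "I (j + 6) = I (j + 5) + 1"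
      using up[of j] up[of "j + 1"] up[of "j + 2"] up[of "j + 3"] up[of "j + 4"] up[of "j + 5"]
      by (simp_all add: eval_nat_numeral)
    then have I: "I (j + 1) = I j + 1" "I (j + 2) = I j + 2" "I (j + 3) = I j" "I (j + 4) = I j + 1"
      "I (j + 5) = I j + 2" "I (j + 6) = I j"
      by simp_all
    moreover have "F (j + 2) = 1" "F (j + 5) = 2" using that(3) F2 by (simp_all only: j add.assoc) simp
    ultimately show False
      using win7[OF \<open>j + 6 < L\<close>] not_tight_ascending by metis
  qed
  have desc: "F (k + 3) = 1" if "1 \<le> k" "k + 3 \<le> p - 2" "F k = 1" for k
  proof (rule ccontr)
    assume "F (k + 3) \<noteq> 1"
    then have F2: "F (k + 3) = 2" using F[of "k + 3"] that pL by simp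
    define j where "j = k - 1"
    have j: "k = j + 1" using that by (simp add: j_def)
    have "j + 6 \<le> p" "j + 6 < L" using that j pL by auto
    then have "I (j + 1) = I j + 2" "I (j + 2) = I (j + 1) + 2" "I (j + 3) = I (j + 2) + 2"
      "I (j + 4) = I (j + 3) + 2" "I (j + 5) = I (j + 4) + 2" "I (j + 6) = I (j + 5) + 2"
      using down[of j] down[of "j + 1"] down[of "j + 2"] down[of "j + 3"] down[of "j + 4"] down[of "j + 5"]
      by (simp_all add: eval_nat_numeral)
    then have I: "I (j + 1) = I j + 2" "I (j + 2) = I j + 1" "I (j + 3) = I j" "I (j + 4) = I j + 2"
      "I (j + 5) = I j + 1" "I (j + 6) = I j"
      by simp_all
    moreover have "F (j + 1) = 1" "F (j + 4) = 2" using that(3) F2 by (simp_all only: j add.assoc) simp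
    ultimately show False
      using win7[OF \<open>j + 6 < L\<close>] not_tight_descending by metis
  qed
  obtain xs where xs: "length xs = 3" "set xs \<subseteq> {..L}"
      "\<And>k. 1 \<le> k \<Longrightarrow> k \<le> p - 2 \<Longrightarrow> F k = threshold xs k"
  proof (rule threshold_code[of 1 "p - 2" F L])
    show "F k = 1 \<or> F k = 2" if "1 \<le> k" "k \<le> p - 2" for k using F[of k] that pL by simp
    show "p - 2 < L" using pL by simp
  qed (use desc in blast)+
  obtain ys where ys: "length ys = 3" "set ys \<subseteq> {..L}"
      "\<And>k. p + 2 \<le> k \<Longrightarrow> k \<le> L - 2 \<Longrightarrow> F k = threshold ys k"
  proof (rule threshold_code[of "p + 2" "L - 2" F L])
    show "F k = 1 \<or> F k = 2" if "p + 2 \<le> k" "k \<le> L - 2" for k using F[of k] that assms(3) by simp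
    show "L - 2 < L" using assms(3) by simp
  qed (use asc in blast)+
  define es where "es = [F 0, F (p - 1), F p, F (p + 1), F (L - 1)]"
  have "w = tight_code L (I 0) p xs ys es"
  proof (rule nth_equalityI)
    show "length w = length (tight_code L (I 0) p xs ys es)"
      by (simp add: tight_code_def assms(2))
    fix k assume "k < length w"
    then have k: "k < L" by (simp add: assms(2))
    have "F k = (if k = 0 then es ! 0 else if k + 1 < p then threshold xs k
      else if k < p + 2 then es ! (k + 2 - p) else if k + 1 < L then threshold ys k else es ! 4)"
    proof -
      consider "k = 0" | "k > 0" "k + 1 < p" | "k > 0" "k + 1 = p" | "k > 0" "k = p"
        | "k > 0" "k = p + 1" | "p + 2 \<le> k" "k + 1 < L" | "p + 2 \<le> k" "k = L - 1"
        using k by linarith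
      then show ?thesis
        by cases (auto simp: es_def eval_nat_numeral xs(3) ys(3))
    qed
    then show "w ! k = tight_code L (I 0) p xs ys es ! k"
      using k I[OF k] w[of k] by (simp add: tight_code_def)
  qed
  moreover have "length es = 5" by (simp add: es_def)
  ultimately show ?thesis using that pL xs(1,2) ys(1,2) by blast
qed

text \<open>There are three choices for the initial index, at most \<open>L + 1\<close> for the turning point and for each of the six
  thresholds, and \<open>3\<^sup>5\<close> for the free exponents.\<close>

lemma card_tight_words:
  assumes "L > 0"
  shows "finite {w. length w = L \<and> tight w}" "card {w. length w = L \<and> tight w} \<le> 729 * (L + 1) ^ 7"
proof -
  let ?T = "{xs :: nat list. set xs \<subseteq> {..L} \<and> length xs = 3}"
  let ?E = "{es :: 3 list. set es \<subseteq> UNIV \<and> length es = 5}"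
  let ?S = "(UNIV :: 3 set) \<times> {..L} \<times> ?T \<times> ?T \<times> ?E"
  let ?f = "\<lambda>(i, p, xs, ys, es). tight_code L i p xs ys es"
  have fin: "finite (UNIV :: 3 set)" and card: "card (UNIV :: 3 set) = 3"
    by simp_all
  have finS: "finite ?S"
    by (intro finite_cartesian_product finite_lists_length_eq fin) auto
  have sub: "{w. length w = L \<and> tight w} \<subseteq> ?f ` ?S"
  proof
    fix w assume "w \<in> {w. length w = L \<and> tight w}"
    then have w: "tight w" "length w = L" by auto
    obtain i p xs ys es where "w = tight_code L i p xs ys es" "p < L"
      "length xs = 3" "set xs \<subseteq> {..L}" "length ys = 3" "set ys \<subseteq> {..L}" "length es = 5"
      using tight_word_is_coded[OF w assms] by blast
    then show "w \<in> ?f ` ?S" by (intro image_eqI[of _ _ "(i, p, xs, ys, es)"]) auto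
  qed
  show "finite {w. length w = L \<and> tight w}"
    using sub finS finite_surj by blast
  have "card {w. length w = L \<and> tight w} \<le> card ?S"
    using surj_card_le[OF finS sub] .
  also have "\<dots> = 3 * ((L + 1) * ((L + 1) ^ 3 * ((L + 1) ^ 3 * 3 ^ 5)))"
    using card_lists_length_eq[OF fin, of 5]
    by (simp add: card_cartesian_product card_lists_length_eq)
  also have "\<dots> = 729 * (L + 1) ^ 7"
  proof -
    have "3 * (M * (M ^ 3 * (M ^ 3 * 3 ^ 5))) = 729 * M ^ 7" for M :: nat
      by (simp add: power_numeral_reduce)
    then show ?thesis .
  qed
  finally show "card {w. length w = L \<and> tight w} \<le> 729 * (L + 1) ^ 7" .
qed

section \<open>Growth of the group and of its sections\<close>

text \<open>Shorter words can be padded with trivial letters, so words of length exactly \<open>n\<close> represent the whole ball.\<close>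

lemma ball_words: "{g \<in> FG. len g \<le> n} = (\<lambda>(w, c). elt w c) ` ({w. length w = n} \<times> UNIV)"
proof (intro equalityI subsetI)
  fix g assume "g \<in> {g \<in> FG. len g \<le> n}"
  then have "g \<in> FG" "len g \<le> n" by auto
  then obtain w c where w: "g = elt w c" "length w \<le> n" by (metis len_word)
  let ?w = "replicate (n - length w) (0, 0) @ w"
  have "elt (replicate k (0, 0)) 0 = id" for k
    by (induction k) (simp_all add: rot_0 spin_0 del: id_apply)
  then have "elt ?w c = g" unfolding elt_append w(1) by simp
  moreover have "length ?w = n" using w(2) by simp
  ultimately show "g \<in> (\<lambda>(w, c). elt w c) ` ({w. length w = n} \<times> UNIV)"
    by (intro image_eqI[of _ _ "(?w, c)"]) auto
next
  fix g assume "g \<in> (\<lambda>(w, c). elt w c) ` ({w. length w = n} \<times> UNIV)"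
  then show "g \<in> {g \<in> FG. len g \<le> n}" using len_le by auto
qed

lemma finite_words: "finite {w :: (3 \<times> 3) list. length w = n}"
  and card_words: "card {w :: (3 \<times> 3) list. length w = n} = 9 ^ n"
proof -
  have fin: "finite (UNIV :: (3 \<times> 3) set)" and card: "card (UNIV :: (3 \<times> 3) set) = 9"
    by simp_all
  show "finite {w :: (3 \<times> 3) list. length w = n}"
    using finite_lists_length_eq[OF fin, of n] by simp
  show "card {w :: (3 \<times> 3) list. length w = n} = 9 ^ n"
    using card_lists_length_eq[OF fin, of n] card by simp
qed

text \<open>The concatenations of \<open>m\<close> blocks of length \<open>L\<close> of which at most \<open>j\<close> are not tight. The bound \<open>j\<close> varies in the
  recursion and is therefore abstracted on the right hand side.\<close>

primrec mostly_tight :: "nat \<Rightarrow> nat \<Rightarrow> nat \<Rightarrow> (3 \<times> 3) list set" where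
  "mostly_tight L 0 = (\<lambda>j. {[]})"
| "mostly_tight L (Suc m) = (\<lambda>j.
     (\<lambda>(u, v). u @ v) ` ({u. length u = L \<and> tight u} \<times> mostly_tight L m j) \<union>
     (if j = 0 then {} else (\<lambda>(u, v). u @ v) ` ({u. length u = L} \<times> mostly_tight L m (j - 1))))"

text \<open>Each block that is not tight saves one letter on the second level.\<close>

lemma mostly_tight_or_short:
  assumes "length w = m * L"
  shows "w \<in> mostly_tight L m j \<or> len2 (elt w c) + j + 1 \<le> m * L"
  using assms
proof (induction m arbitrary: w j)
  case (Suc m)
  define u v where "u = take L w" and "v = drop L w"
  have uv: "w = u @ v" "length u = L" "length v = m * L"
    using Suc.prems by (simp_all add: u_def v_def)
  have le: "len2 (elt w c) \<le> len2 (elt u 0) + len2 (elt v c)"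
    unfolding uv(1) by (rule len2_append)
  have uL: "len2 (elt u 0) \<le> L" using length_like_elt[OF length_like_len2, of u 0] uv(2) by simp
  have vL: "len2 (elt v c) \<le> m * L" using length_like_elt[OF length_like_len2, of v c] uv(3) by simp
  show ?case
  proof (cases "tight u")
    case True
    from Suc.IH[OF uv(3), of j] show ?thesis
    proof
      assume "v \<in> mostly_tight L m j"
      then have "w \<in> mostly_tight L (Suc m) j"
        using uv True by (auto intro!: image_eqI[of _ _ "(u, v)"])
      then show ?thesis ..
    qed (use le uL in simp)
  next
    case False
    then have u: "len2 (elt u 0) + 1 \<le> L" using uv(2) by (simp add: tight_def)
    show ?thesis
    proof (cases "j = 0")
      case True
      then show ?thesis using le u vL by simp
    next
      case j: False
      from Suc.IH[OF uv(3), of "j - 1"] show ?thesis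
      proof
        assume "v \<in> mostly_tight L m (j - 1)"
        then have "w \<in> mostly_tight L (Suc m) j"
          using uv j by (auto intro!: image_eqI[of _ _ "(u, v)"])
        then show ?thesis ..
      qed (use le u j in simp)
    qed
  qed
qed simp

text \<open>The factor \<open>2\<^sup>m\<close> accounts for the choice of the blocks that may fail to be tight, and only those
  cost the full number \<open>9\<^sup>L\<close> of words.\<close>

lemma card_mostly_tight:
  assumes "finite {u. length u = L \<and> tight u}" "card {u. length u = L \<and> tight u} \<le> B" "B \<ge> 1"
  shows "finite (mostly_tight L m j) \<and> card (mostly_tight L m j) \<le> (2 * B) ^ m * (9 ^ L) ^ j"
proof (induction m arbitrary: j)
  case 0
  then show ?case by simp
next
  case (Suc m)
  let ?cat = "\<lambda>(u, v). u @ v :: (3 \<times> 3) list"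
  let ?T = "{u. length u = L \<and> tight u}" and ?W = "{u :: (3 \<times> 3) list. length u = L}"
  let ?R = "\<lambda>j. mostly_tight L m j"
  let ?b = "\<lambda>j. (2 * B) ^ m * (9 ^ L) ^ j"
  have fin: "finite (?cat ` (?T \<times> ?R j))" "finite (?cat ` (?W \<times> ?R j))" for j
    using Suc assms(1) finite_words[of L] by blast+
  have T: "card (?cat ` (?T \<times> ?R j)) \<le> B * ?b j"
  proof -
    have "card (?cat ` (?T \<times> ?R j)) \<le> card (?T \<times> ?R j)"
      using Suc assms(1) by (intro card_image_le) simp
    also have "\<dots> \<le> B * ?b j"
      unfolding card_cartesian_product using Suc assms(2) by (intro mult_le_mono) auto
    finally show ?thesis .
  qed
  show ?case
  proof (cases "j = 0")
    case True
    then show ?thesis using T fin by simp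
  next
    case False
    have W: "card (?cat ` (?W \<times> ?R (j - 1))) \<le> B * ?b j"
    proof -
      have "card (?cat ` (?W \<times> ?R (j - 1))) \<le> card (?W \<times> ?R (j - 1))"
        using Suc finite_words by (intro card_image_le) simp
      also have "\<dots> \<le> 9 ^ L * ?b (j - 1)"
        unfolding card_cartesian_product card_words using Suc by (intro mult_le_mono) auto
      also have "\<dots> = ?b j" using False by (cases j) simp_all
      also have "\<dots> \<le> B * ?b j" using assms(3) by simp
      finally show ?thesis .
    qed
    have "mostly_tight L (Suc m) j = ?cat ` (?T \<times> ?R j) \<union> ?cat ` (?W \<times> ?R (j - 1))"
      using False by simp
    then show ?thesis
      using card_Un_le[of "?cat ` (?T \<times> ?R j)" "?cat ` (?W \<times> ?R (j - 1))"] T W fin by simp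
  qed
qed

lemma finite_ball: "finite {g \<in> FG. len g \<le> n}"
  and card_ball: "card {g \<in> FG. len g \<le> n} \<le> 3 * 9 ^ n"
proof -
  have fin: "finite ({w :: (3 \<times> 3) list. length w = n} \<times> (UNIV :: 3 set))"
    using finite_words by (intro finite_cartesian_product) simp_all
  then show "finite {g \<in> FG. len g \<le> n}" unfolding ball_words by (rule finite_imageI)
  have "card {g \<in> FG. len g \<le> n} \<le> card ({w :: (3 \<times> 3) list. length w = n} \<times> (UNIV :: 3 set))"
    unfolding ball_words using fin by (rule card_image_le)
  also have "\<dots> = 3 * 9 ^ n"
    unfolding card_cartesian_product card_words by simp
  finally show "card {g \<in> FG. len g \<le> n} \<le> 3 * 9 ^ n" .
qed

definition growth_le :: "((3 list \<Rightarrow> 3 list) \<Rightarrow> nat) \<Rightarrow> real \<Rightarrow> bool" where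
  "growth_le \<nu> \<eta> \<longleftrightarrow> (\<exists>C. \<forall>n. finite {g \<in> FG. \<nu> g \<le> n} \<and> real (card {g \<in> FG. \<nu> g \<le> n}) \<le> C * \<eta> ^ n)"

text \<open>Bernoulli's inequality for the \<open>d\<close>-th root of \<open>x\<close>.\<close>

lemma poly_le_exp:
  fixes x :: real
  assumes "x > 1" "d > 0"
  obtains K where "K > 0" "\<And>n. (real n + 1) ^ d \<le> K * x ^ n"
proof -
  define r where "r = root d x"
  have r: "r > 1" "r ^ d = x" using assms by (simp_all add: r_def)
  define k where "k = max 1 (1 / (r - 1))"
  have "real n + 1 \<le> k * r ^ n" for n
  proof -
    have "1 + real n * (r - 1) \<le> (1 + (r - 1)) ^ n"
      using r by (intro Bernoulli_inequality) simp
    then have "k * (1 + real n * (r - 1)) \<le> k * r ^ n"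
      by (intro mult_left_mono) (auto simp: k_def)
    moreover have "1 \<le> k" "1 \<le> k * (r - 1)"
      using r by (auto simp: k_def max_def field_simps)
    then have "1 + real n * 1 \<le> k + real n * (k * (r - 1))"
      by (intro add_mono mult_left_mono) auto
    ultimately show ?thesis by (simp add: algebra_simps)
  qed
  then have "(real n + 1) ^ d \<le> (k * r ^ n) ^ d" for n
    by (intro power_mono) auto
  also have "(k * r ^ n) ^ d = k ^ d * x ^ n" for n
    by (simp add: power_mult_distrib power_mult[symmetric] mult.commute r(2)[symmetric])
  finally show ?thesis by (intro that[of "k ^ d"]) (auto simp: k_def)
qed

lemma FG_section_code_inj:
  "inj_on (\<lambda>g. (g [0], sec g 0, sec g 1, sec g 2)) FG"
proof (rule inj_onI)
  fix g h assume g: "g \<in> FG" and h: "h \<in> FG"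
    and eq: "(g [0], sec g 0, sec g 1, sec g 2) = (h [0], sec h 0, sec h 1, sec h 2)"
  obtain c d where cd: "shifts g c" "shifts h d" using FG_shifts g h by blast
  then have "g [0] = c # sec g 0 []" "h [0] = d # sec h 0 []" by (simp_all add: shifts_def)
  with eq have "c = d" by simp
  with cd show "g = h"
  proof (intro FG_eqI[OF g h])
    show "sec g x = sec h x" for x using alphabet_cases[of x] eq by auto
  qed auto
qed

text \<open>An element is determined by its action on the first level and its three sections. The number of ways to
  distribute a total length \<open>n\<close> over three sections is polynomial in \<open>n\<close>, and the products of the three ball
  sizes are of order \<open>\<eta>\<^sup>n\<close>; the slightly larger base absorbs the polynomial.\<close>

lemma growth_le_secsum:
  assumes "growth_le \<nu> \<eta>" "1 \<le> \<eta>" "\<eta> < \<eta>'"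
  shows "growth_le (secsum \<nu>) \<eta>'"
proof -
  let ?X = "\<lambda>n. {g \<in> FG. \<nu> g \<le> n}" and ?Y = "\<lambda>n. {g \<in> FG. secsum \<nu> g \<le> n}"
  obtain C where C: "\<And>n. finite (?X n)" "\<And>n. real (card (?X n)) \<le> C * \<eta> ^ n"
    using assms(1) by (auto simp: growth_le_def)
  have "0 \<le> C * \<eta> ^ 0" using C(2)[of 0] order_trans of_nat_0_le_iff by blast
  then have "C \<ge> 0" by simp
  obtain K where K: "K > 0" "\<And>n. (real n + 1) ^ 3 \<le> K * (\<eta>' / \<eta>) ^ n"
    using poly_le_exp[of "\<eta>' / \<eta>" 3] assms by auto
  have bound: "finite (?Y n) \<and> real (card (?Y n)) \<le> (3 * C ^ 3 * K) * \<eta>' ^ n" for n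
  proof -
    let ?T = "{(a, b, c). a \<le> n \<and> b \<le> n \<and> c \<le> n \<and> a + b + c \<le> n}"
    let ?Z = "\<lambda>(a, b, c). {[0], [1], [2 :: 3]} \<times> ?X a \<times> ?X b \<times> ?X c"
    let ?f = "\<lambda>g. (g [0], sec g 0, sec g 1, sec g 2)"
    have Tsub: "?T \<subseteq> {..n} \<times> {..n} \<times> {..n}" by auto
    then have finT: "finite ?T" by (rule finite_subset) simp
    have cardT: "card ?T \<le> (n + 1) ^ 3"
    proof -
      have "card ?T \<le> card ({..n} \<times> {..n} \<times> {..n})" using Tsub by (intro card_mono) auto
      also have "\<dots> = (n + 1) ^ 3" by (simp add: card_cartesian_product power3_eq_cube)
      finally show ?thesis .
    qed
    have finZ: "finite (?Z t)" for t using C(1) by (auto split: prod.split)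
    have cardZ: "real (card (?Z t)) \<le> 3 * C ^ 3 * \<eta> ^ n" if "t \<in> ?T" for t
    proof -
      obtain a b c where t: "t = (a, b, c)" by (cases t)
      with that have abc: "a + b + c \<le> n" by simp
      have "real (card (?Z t)) = 3 * (real (card (?X a)) * (real (card (?X b)) * real (card (?X c))))"
        by (simp add: t card_cartesian_product)
      also have "\<dots> \<le> 3 * ((C * \<eta> ^ a) * ((C * \<eta> ^ b) * (C * \<eta> ^ c)))"
        using C(2) \<open>C \<ge> 0\<close> assms(2) by (intro mult_left_mono mult_mono mult_nonneg_nonneg) auto
      also have "\<dots> = 3 * C ^ 3 * \<eta> ^ (a + b + c)" by (simp add: power_add power3_eq_cube)
      also have "\<dots> \<le> 3 * C ^ 3 * \<eta> ^ n"
        using abc assms(2) \<open>C \<ge> 0\<close> by (intro mult_left_mono power_increasing) auto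
      finally show ?thesis .
    qed
    have sub: "?f ` ?Y n \<subseteq> (\<Union>t\<in>?T. ?Z t)"
    proof
      fix y assume "y \<in> ?f ` ?Y n"
      then obtain g where g: "g \<in> FG" "secsum \<nu> g \<le> n" "y = ?f g" by blast
      then have le: "\<nu> (sec g 0) + \<nu> (sec g 1) + \<nu> (sec g 2) \<le> n"
        using sum_alphabet[of "\<lambda>x. \<nu> (sec g x)" 0] by (simp add: secsum_def)
      obtain c where "shifts g c" using FG_shifts g by blast
      then have "g [0] = c # sec g 0 []" by (simp add: shifts_def)
      moreover have "sec g 0 [] = []" by (rule FG_Nil[OF sec_in_FG[OF g(1)]])
      ultimately have "g [0] \<in> {[0], [1], [2 :: 3]}" using alphabet_cases[of c] by auto
      then have "y \<in> ?Z (\<nu> (sec g 0), \<nu> (sec g 1), \<nu> (sec g 2))"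
        using g(1) by (simp add: g(3) sec_in_FG)
      moreover have "(\<nu> (sec g 0), \<nu> (sec g 1), \<nu> (sec g 2)) \<in> ?T" using le by simp
      ultimately show "y \<in> (\<Union>t\<in>?T. ?Z t)" by blast
    qed
    have finU: "finite (\<Union>t\<in>?T. ?Z t)" using finT finZ by blast
    have inj: "inj_on ?f (?Y n)" using FG_section_code_inj by (rule inj_on_subset) blast
    have fin: "finite (?Y n)" using finite_imageD[OF finite_subset[OF sub finU] inj] .
    have "card (?Y n) \<le> card (\<Union>t\<in>?T. ?Z t)"
      using card_image[OF inj] card_mono[OF finU sub] by simp
    also have "\<dots> \<le> (\<Sum>t\<in>?T. card (?Z t))" by (rule card_UN_le[OF finT])
    finally have "real (card (?Y n)) \<le> real (\<Sum>t\<in>?T. card (?Z t))" by (rule of_nat_mono)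
    also have "\<dots> = (\<Sum>t\<in>?T. real (card (?Z t)))" by (rule of_nat_sum)
    also have "\<dots> \<le> of_nat (card ?T) * (3 * C ^ 3 * \<eta> ^ n)"
      using cardZ by (rule sum_bounded_above)
    also have "\<dots> \<le> (real n + 1) ^ 3 * (3 * C ^ 3 * \<eta> ^ n)"
    proof (rule mult_right_mono)
      have "real (card ?T) \<le> real ((n + 1) ^ 3)" using cardT by (rule of_nat_mono)
      also have "real ((n + 1) ^ 3) = (real n + 1) ^ 3" by (simp add: add.commute)
      finally show "real (card ?T) \<le> (real n + 1) ^ 3" .
    qed (use \<open>C \<ge> 0\<close> assms(2) in simp)
    also have "\<dots> \<le> (K * (\<eta>' / \<eta>) ^ n) * (3 * C ^ 3 * \<eta> ^ n)"
      using K(2)[of n] \<open>C \<ge> 0\<close> assms(2) by (intro mult_right_mono) auto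
    also have "\<dots> = (3 * C ^ 3 * K) * \<eta>' ^ n"
      using assms(2) by (simp add: power_divide)
    finally show ?thesis using fin by blast
  qed
  then show ?thesis unfolding growth_le_def by blast
qed

section \<open>Subexponential growth\<close>

text \<open>The parameters are chosen in this order. A proportion \<open>1/s\<close> of blocks that are not tight contributes
  \<open>9\<^sup>1\<^sup>/\<^sup>s\<close> to the growth rate, which is made smaller than \<open>\<rho>\<^sup>1\<^sup>/\<^sup>2\<close>. Next, \<open>L\<close> is so large that the other choices contribute
  less than \<open>\<rho>\<^sup>1\<^sup>/\<^sup>2\<close> as well; this is possible because the number of tight words is polynomial in \<open>L\<close>.
  The remaining elements save one letter out of \<open>T = L s\<close> on the second level, so a base \<open>\<eta>\<close> close enough
  to \<open>\<rho>\<close> yields growth rate \<open>\<eta>\<^sup>1\<^sup>-\<^sup>1\<^sup>/\<^sup>T < \<rho>\<close> for them.\<close>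

lemma growth_le_improve:
  fixes \<rho> :: real
  assumes "\<rho> > 1" and approx: "\<And>\<mu>. \<mu> > \<rho> \<Longrightarrow> \<exists>\<eta>. 1 \<le> \<eta> \<and> \<eta> < \<mu> \<and> growth_le len \<eta>"
  shows "\<exists>\<theta>. 1 \<le> \<theta> \<and> \<theta> < \<rho> \<and> growth_le len \<theta>"
proof -
  obtain s :: nat where s: "81 < \<rho> ^ s"
    using real_arch_pow[OF assms(1)] by blast
  then have "s > 0" by (cases s) auto
  obtain K where K: "K > 0" "\<And>n. (real n + 1) ^ 14 \<le> K * (sqrt \<rho>) ^ n"
    using poly_le_exp[of "sqrt \<rho>" 14] assms(1) by auto
  obtain L :: nat where L: "1458\<^sup>2 * K < (sqrt \<rho>) ^ L" "L > 0"
  proof -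
    obtain L where L: "max 1 (1458\<^sup>2 * K) < (sqrt \<rho>) ^ L"
      using real_arch_pow[of "sqrt \<rho>" "max 1 (1458\<^sup>2 * K)"] assms(1) real_sqrt_gt_1_iff by blast
    then have "L > 0" by (cases L) auto
    with L show ?thesis by (intro that[of L]) auto
  qed
  define B :: nat where "B = 729 * (L + 1) ^ 7"
  have B: "(2 * real B)\<^sup>2 < \<rho> ^ L"
  proof -
    have "(2 * real B)\<^sup>2 = 1458\<^sup>2 * (real L + 1) ^ 14"
      by (simp add: B_def power_mult_distrib power_mult[symmetric] add.commute)
    also have "\<dots> \<le> 1458\<^sup>2 * (K * (sqrt \<rho>) ^ L)" using K(2)[of L] by simp
    also have "\<dots> = (1458\<^sup>2 * K) * (sqrt \<rho>) ^ L" by simp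
    also have "\<dots> < (sqrt \<rho>) ^ L * (sqrt \<rho>) ^ L" using L assms(1) by (intro mult_strict_right_mono) auto
    also have "\<dots> = \<rho> ^ L" using assms(1) by (simp flip: power_mult_distrib)
    finally show ?thesis .
  qed
  have "B \<ge> 1" by (simp add: B_def)
  define T where "T = L * s"
  have "T > 0" using \<open>s > 0\<close> L(2) by (simp add: T_def)
  \<comment> \<open>The words with few blocks that are not tight grow like \<open>\<kappa>\<close> to the power \<open>n/T\<close>.\<close>
  define \<kappa> :: real where "\<kappa> = (2 * real B) ^ s * 9 ^ L"
  have "\<kappa> \<ge> 0" by (simp add: \<kappa>_def)
  have "\<kappa>\<^sup>2 = ((2 * real B)\<^sup>2) ^ s * 81 ^ L"
  proof -
    have "(x ^ n)\<^sup>2 = (x\<^sup>2) ^ n" for x :: real and n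
      by (simp only: power_mult[symmetric] mult.commute)
    from this[of "2 * real B" s] this[of 9 L] show ?thesis
      unfolding \<kappa>_def power_mult_distrib by simp
  qed
  also have "\<dots> < (\<rho> ^ L) ^ s * (\<rho> ^ s) ^ L"
    using B s \<open>s > 0\<close> L(2) assms(1) \<open>B \<ge> 1\<close>
    by (intro mult_strict_mono power_strict_mono zero_less_power) auto
  also have "\<dots> = (\<rho> ^ T)\<^sup>2" by (simp add: T_def power_mult[symmetric] power2_eq_square mult.commute)
  finally have \<kappa>: "\<kappa> < \<rho> ^ T" using assms(1) by (intro power_less_imp_less_base[of \<kappa> 2]) auto

  \<comment> \<open>A base above \<open>\<rho>\<close> for which \<open>T - 1\<close> factors still stay below \<open>\<rho>\<^sup>T\<close>.\<close>
  define \<eta> where "\<eta> = \<rho> * root T \<rho>"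
  have root: "root T \<rho> > 1" using assms(1) \<open>T > 0\<close> by simp
  have "\<eta> > \<rho>" using root assms(1) by (simp add: \<eta>_def)
  have "\<eta> ^ (T - 1) = \<rho> ^ (T - 1) * root T \<rho> ^ (T - 1)" by (simp add: \<eta>_def power_mult_distrib)
  also have "\<dots> < \<rho> ^ (T - 1) * root T \<rho> ^ T"
    using root assms(1) \<open>T > 0\<close> by (intro mult_strict_left_mono power_strict_increasing) auto
  also have "\<dots> = \<rho> ^ T" using assms(1) \<open>T > 0\<close> power_minus_mult[of T \<rho>] by simp
  finally have \<eta>: "\<eta> ^ (T - 1) < \<rho> ^ T" .

  define \<theta> where "\<theta> = max 1 (root T (max \<kappa> (\<eta> ^ (T - 1))))"
  have "root T (max \<kappa> (\<eta> ^ (T - 1))) < root T (\<rho> ^ T)"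
    using \<kappa> \<eta> \<open>T > 0\<close> by simp
  also have "\<dots> = \<rho>" using assms(1) \<open>T > 0\<close> by (simp add: real_root_power_cancel)
  finally have "\<theta> < \<rho>" using assms(1) by (simp add: \<theta>_def)
  have "\<theta> \<ge> 1" by (simp add: \<theta>_def)
  have "max \<kappa> (\<eta> ^ (T - 1)) = root T (max \<kappa> (\<eta> ^ (T - 1))) ^ T"
    using \<open>T > 0\<close> \<open>\<kappa> \<ge> 0\<close> by (simp add: le_max_iff_disj)
  also have "\<dots> \<le> \<theta> ^ T"
    using \<open>T > 0\<close> \<open>\<kappa> \<ge> 0\<close> by (intro power_mono) (auto simp: \<theta>_def le_max_iff_disj)
  finally have \<theta>T: "\<kappa> \<le> \<theta> ^ T" "\<eta> ^ (T - 1) \<le> \<theta> ^ T" by simp_all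

  \<comment> \<open>Two passages to sections, each of which enlarges the base a little.\<close>
  have "growth_le len2 \<eta>"
  proof -
    obtain \<eta>1 where \<eta>1: "1 \<le> \<eta>1" "\<eta>1 < \<eta>" "growth_le len \<eta>1" using approx[OF \<open>\<eta> > \<rho>\<close>] by blast
    have mid: "growth_le (secsum len) ((\<eta>1 + \<eta>) / 2)"
      using \<eta>1 by (intro growth_le_secsum[OF \<eta>1(3)]) auto
    show ?thesis unfolding len2_def
      by (rule growth_le_secsum[OF mid]) (use \<eta>1 in auto)
  qed
  then obtain C where C: "\<And>n. finite {g \<in> FG. len2 g \<le> n}"
    "\<And>n. real (card {g \<in> FG. len2 g \<le> n}) \<le> C * \<eta> ^ n" by (auto simp: growth_le_def)
  have "0 \<le> C * \<eta> ^ 0" using C(2)[of 0] order_trans of_nat_0_le_iff by blast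
  then have "C \<ge> 0" by simp

  have main: "real (card {g \<in> FG. len g \<le> T * M}) \<le> (3 + C) * \<theta> ^ (T * M)" for M
  proof -
    let ?R = "mostly_tight L (s * M) M"
    let ?A = "(\<lambda>(w, c). elt w c) ` (?R \<times> (UNIV :: 3 set))" and ?D = "{g \<in> FG. len2 g \<le> (T - 1) * M}"
    have T': "s * M * L = T * M" by (simp add: T_def mult_ac)
    have R: "finite ?R" "card ?R \<le> (2 * B) ^ (s * M) * (9 ^ L) ^ M"
      using card_mostly_tight[OF card_tight_words[OF L(2), folded B_def] \<open>B \<ge> 1\<close>] by blast+
    \<comment> \<open>With \<open>s M\<close> blocks and \<open>j = M\<close>, the alternative saves more than \<open>M\<close> of the \<open>T M\<close> letters.\<close>
    have sub: "{g \<in> FG. len g \<le> T * M} \<subseteq> ?A \<union> ?D"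
    proof
      fix g assume "g \<in> {g \<in> FG. len g \<le> T * M}"
      then obtain w c where w: "length w = s * M * L" "g = elt w c" unfolding ball_words T' by auto
      from mostly_tight_or_short[OF w(1), of M c] show "g \<in> ?A \<union> ?D"
      proof
        assume "w \<in> ?R"
        then have "g \<in> ?A" unfolding w(2) by (intro image_eqI[of _ _ "(w, c)"]) auto
        then show ?thesis ..
      next
        assume "len2 (elt w c) + M + 1 \<le> s * M * L"
        then have "len2 g \<le> (T - 1) * M" unfolding T' w(2) by (simp add: diff_mult_distrib)
        then show ?thesis unfolding w(2) by blast
      qed
    qed
    have finA: "finite ?A" using R(1) by simp
    have "card ?A \<le> card (?R \<times> (UNIV :: 3 set))" using R(1) by (intro card_image_le) simp
    then have "card ?A \<le> 3 * ((2 * B) ^ (s * M) * (9 ^ L) ^ M)"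
      using R(2) by (simp add: card_cartesian_product)
    then have "real (card ?A) \<le> real (3 * ((2 * B) ^ (s * M) * (9 ^ L) ^ M))" by (rule of_nat_mono)
    also have "\<dots> = 3 * \<kappa> ^ M" by (simp add: \<kappa>_def power_mult_distrib power_mult)
    also have "\<dots> \<le> 3 * (\<theta> ^ T) ^ M" using \<theta>T(1) \<open>\<kappa> \<ge> 0\<close> by (intro mult_left_mono power_mono) auto
    finally have A: "real (card ?A) \<le> 3 * \<theta> ^ (T * M)" by (simp add: power_mult)
    have "real (card ?D) \<le> C * (\<eta> ^ (T - 1)) ^ M" using C(2)[of "(T - 1) * M"] by (simp add: power_mult)
    also have "\<dots> \<le> C * (\<theta> ^ T) ^ M"
      using \<theta>T(2) \<open>C \<ge> 0\<close> \<open>\<eta> > \<rho>\<close> assms(1) by (intro mult_left_mono power_mono) auto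
    finally have D: "real (card ?D) \<le> C * \<theta> ^ (T * M)" by (simp add: power_mult)
    have "card {g \<in> FG. len g \<le> T * M} \<le> card (?A \<union> ?D)"
      using sub finA C(1) by (intro card_mono) auto
    also have "\<dots> \<le> card ?A + card ?D" by (rule card_Un_le)
    finally have "real (card {g \<in> FG. len g \<le> T * M}) \<le> real (card ?A) + real (card ?D)"
      by (simp flip: of_nat_add)
    with A D show ?thesis by (simp add: algebra_simps)
  qed
  have "real (card {g \<in> FG. len g \<le> n}) \<le> ((3 + C) * \<theta> ^ T) * \<theta> ^ n" for n
  proof -
    \<comment> \<open>Any \<open>n\<close> is rounded up to the next multiple of \<open>T\<close>, at the cost of the constant \<open>\<theta>\<^sup>T\<close>.\<close>
    define M where "M = n div T + 1"
    have M: "n \<le> T * M" "T * M \<le> T + n"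
      using \<open>T > 0\<close> dividend_less_times_div[of T n] by (auto simp: M_def algebra_simps less_imp_le)
    have "card {g \<in> FG. len g \<le> n} \<le> card {g \<in> FG. len g \<le> T * M}"
      using M(1) finite_ball by (intro card_mono) auto
    then have "real (card {g \<in> FG. len g \<le> n}) \<le> (3 + C) * \<theta> ^ (T * M)"
      using main[of M] by linarith
    also have "\<dots> \<le> (3 + C) * \<theta> ^ (T + n)"
      using M(2) \<open>\<theta> \<ge> 1\<close> \<open>C \<ge> 0\<close> by (intro mult_left_mono power_increasing) auto
    finally show ?thesis by (simp add: power_add mult.assoc)
  qed
  then have "growth_le len \<theta>" unfolding growth_le_def using finite_ball by blast
  with \<open>\<theta> \<ge> 1\<close> \<open>\<theta> < \<rho>\<close> show ?thesis by blast
qed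

text \<open>The infimum of the bases that bound the growth cannot exceed \<open>1\<close>, since it could be improved.\<close>

lemma FG_subexponential:
  assumes "\<mu> > 1"
  shows "\<exists>\<eta>. 1 \<le> \<eta> \<and> \<eta> < \<mu> \<and> growth_le len \<eta>"
proof -
  define E where "E = {\<eta>. 1 \<le> \<eta> \<and> growth_le len \<eta>}"
  have "growth_le len 9"
    unfolding growth_le_def
  proof (intro exI allI conjI finite_ball)
    show "real (card {g \<in> FG. len g \<le> n}) \<le> 3 * 9 ^ n" for n
      using of_nat_mono[OF card_ball[of n], where 'a = real] by simp
  qed
  then have "9 \<in> E" by (simp add: E_def)
  have bdd: "bdd_below E" by (rule bdd_belowI[of _ 1]) (simp add: E_def)
  have approx: "\<exists>\<eta>. 1 \<le> \<eta> \<and> \<eta> < x \<and> growth_le len \<eta>" if x: "x > Inf E" for x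
  proof -
    obtain \<eta> where "\<eta> \<in> E" "\<eta> < x" using cInf_lessD[OF _ x] \<open>9 \<in> E\<close> by blast
    then show ?thesis by (auto simp: E_def)
  qed
  have "Inf E \<le> 1"
  proof (rule ccontr)
    assume "\<not> Inf E \<le> 1"
    then obtain \<theta> where "1 \<le> \<theta>" "\<theta> < Inf E" "growth_le len \<theta>"
      using growth_le_improve[of "Inf E"] approx by auto
    then have "\<theta> \<in> E" by (simp add: E_def)
    then have "Inf E \<le> \<theta>" using bdd by (rule cInf_lower)
    with \<open>\<theta> < Inf E\<close> show False by simp
  qed
  with assms show ?thesis by (intro approx) simp
qed

text \<open>The \<open>2\<^sup>n\<close> words of length \<open>n\<close> in two free generators would be distinct elements of a ball of radius \<open>k n\<close>,
  of which there are only of order \<open>(3/2)\<^sup>n\<close>.\<close>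

lemma FG_no_free_subsemigroup: "\<not> contains_free_subsemigroup_2 FG_group"
proof
  let ?F = "free_semigroup {..<2::nat}"
  assume "contains_free_subsemigroup_2 FG_group"
  then obtain \<phi> where hom: "\<phi> \<in> hom ?F FG_group" and inj: "inj_on \<phi> (carrier ?F)"
    by (auto simp: contains_free_subsemigroup_2_def mon_def)
  have F: "w \<in> carrier ?F \<longleftrightarrow> w \<noteq> [] \<and> set w \<subseteq> {..<2}" for w
    by (simp add: free_semigroup_def)
  have FG: "\<phi> w \<in> FG" if "w \<in> carrier ?F" for w
    using hom_in_carrier[OF hom that] by (simp add: carrier_FG)
  have mult: "\<phi> (u @ v) = \<phi> u \<circ> \<phi> v" if "u \<in> carrier ?F" "v \<in> carrier ?F" for u v
    using hom_mult[OF hom that] FG that by (simp add: mult_FG free_semigroup_def)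
  define k where "k = len (\<phi> [0]) + len (\<phi> [1]) + 1"
  have letter: "len (\<phi> [x]) \<le> k" if "x \<in> {..<2}" for x
  proof -
    have "x = 0 \<or> x = 1" using that by auto
    then show ?thesis by (auto simp: k_def)
  qed
  have length: "len (\<phi> w) \<le> k * length w" if "w \<in> carrier ?F" for w
    using that
  proof (induction w)
    case (Cons x w)
    then have x: "[x] \<in> carrier ?F" "x \<in> {..<2}" by (auto simp: F)
    show ?case
    proof (cases "w = []")
      case True
      then show ?thesis using letter x by simp
    next
      case False
      with Cons.prems have w: "w \<in> carrier ?F" by (simp add: F)
      have "len (\<phi> (x # w)) \<le> len (\<phi> [x]) + len (\<phi> w)"
        using mult[OF x(1) w] length_like_comp[OF length_like_len FG[OF x(1)] FG[OF w]]
        by (simp del: comp_apply)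
      then show ?thesis using Cons.IH[OF w] letter[OF x(2)] by simp
    qed
  qed (simp add: F)
  have "root k (3 / 2) > 1" by (simp add: k_def)
  then obtain \<eta> where \<eta>: "1 \<le> \<eta>" "\<eta> < root k (3 / 2)" "growth_le len \<eta>"
    using FG_subexponential by blast
  then obtain C where C: "\<And>n. real (card {g \<in> FG. len g \<le> n}) \<le> C * \<eta> ^ n"
    by (auto simp: growth_le_def)
  have "0 \<le> C * \<eta> ^ 0" using C[of 0] order_trans of_nat_0_le_iff by blast
  then have "C \<ge> 0" by simp
  have "\<eta> ^ k \<le> root k (3 / 2) ^ k" using \<eta> by (intro power_mono) auto
  also have "\<dots> = 3 / 2" by (simp add: k_def del: power_Suc)
  finally have \<eta>k: "\<eta> ^ k \<le> 3 / 2" .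
  have bound: "2 ^ n \<le> C * (3 / 2) ^ n" if "n > 0" for n
  proof -
    let ?W = "{w. set w \<subseteq> {..<2::nat} \<and> length w = n}"
    have W: "?W \<subseteq> carrier ?F" using that by (auto simp: F)
    have "2 ^ n = card ?W" by (simp add: card_lists_length_eq)
    also have "\<dots> = card (\<phi> ` ?W)" using inj_on_subset[OF inj W] by (simp add: card_image)
    also have "\<dots> \<le> card {g \<in> FG. len g \<le> k * n}"
      using FG length W by (intro card_mono finite_ball) auto
    finally have "real (2 ^ n) \<le> real (card {g \<in> FG. len g \<le> k * n})" by (rule of_nat_mono)
    also have "\<dots> \<le> C * (\<eta> ^ k) ^ n" using C[of "k * n"] by (simp add: power_mult)
    also have "\<dots> \<le> C * (3 / 2) ^ n"
      using \<eta>k \<eta>(1) \<open>C \<ge> 0\<close> by (intro mult_left_mono power_mono) auto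
    finally show ?thesis by simp
  qed
  obtain n where n: "C < (4 / 3 :: real) ^ n" using real_arch_pow[of "4 / 3" C] by auto
  also have "\<dots> \<le> (4 / 3) ^ Suc n" by simp
  finally have "C * (3 / 2) ^ Suc n < (4 / 3) ^ Suc n * (3 / 2) ^ Suc n"
    by (intro mult_strict_right_mono) auto
  also have "\<dots> = 2 ^ Suc n" by (simp flip: power_mult_distrib del: power_Suc)
  finally show False using bound[of "Suc n"] by simp
qed

section \<open>Conclusion\<close>

theorem theorem1p3:
  shows "(\<exists>S. S \<subseteq> carrier FG_group \<and> card S = 2 \<and> generate FG_group S = carrier FG_group)
    \<and> \<not> contains_free_subsemigroup_2 FG_group
    \<and> \<not> (\<exists>(N :: 'n monoid) (P :: 'p monoid) i p.
          short_exact_sequence N i FG_group p P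
          \<and> locally_nilpotent_group N \<and> periodic_group P)"
proof (intro conjI)
  show "\<exists>S. S \<subseteq> carrier FG_group \<and> card S = 2 \<and> generate FG_group S = carrier FG_group"
    by (rule FG_two_generated)
  show "\<not> contains_free_subsemigroup_2 FG_group"
    by (rule FG_no_free_subsemigroup)
  show "\<not> (\<exists>(N :: 'n monoid) (P :: 'p monoid) i p.
          short_exact_sequence N i FG_group p P
          \<and> locally_nilpotent_group N \<and> periodic_group P)"
    using locally_nilpotent_kernel_contradiction by blast
qed

end
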